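(* Suppose the following conjecture is true: the function $\psi$ given by the affine Laumon partition function of type $A_{N-1}^{(1)}$ (defined in the context) satisfies the non-stationary $\widehat{\mathfrak{gl}}_N$ difference equation $\mathcal{H}\psi=\psi$. Let $q=e^h$, $d_a=q^{m_a}$, $\overline{d}_a=q^{\tilde m_a}$, $\kappa\, b_a/b_{a+1}=q^{\gamma_a}$ ($a\in\mathbb{Z}/N\mathbb{Z}$), and let $\psi_{5d}$ be the five-dimensional affine Laumon function, normalized as in the context so that the conjectured equation reads $$(A_1-A_2)\,\psi_{5d}=0,$$ $$A_1=\ :\prod_{a=1}^N\frac{(q^{\vartheta'_a+\tilde m_a}x_a;q)_\infty}{(x_a;q)_\infty}\,q^{\gamma_a\vartheta_a}:\,,\qquad A_2=\ :\prod_{a=1}^N\frac{(q^{\tilde m_a-m_a}x_a;q)_\infty}{(q^{-\vartheta'_a-m_a}x_a;q)_\infty}\,q^{-\vartheta_a\vartheta'_a}:\,.$$ Then the four-dimensional limit $\psi_{4d}=\psi_{5d}\big|_{h\to0}$ of the partition function satisfies $$\sum_{a=1}^N\Big\{\vartheta_a(\vartheta'_a+\gamma_a)+\frac{U_a}{1-\Lambda}\,(m_a+\vartheta'_a)(\tilde m_a+\vartheta'_a)\Big\}\psi_{4d}=0 .$$ Namely, the equation $(A_1-A_2)\psi_{5d}=0$ implies this equation for $\psi_{4d}$.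
   Context: Indices are in $\mathbb{Z}/N\mathbb{Z}$. $\vartheta_a=x_a\frac{\partial}{\partial x_a}$, $\vartheta'_a=\vartheta_a-\vartheta_{a-1}$, $\Lambda=x_1x_2\cdots x_N$, and $U_a=x_a+x_ax_{a+1}+\cdots+x_ax_{a+1}\cdots x_{a+N-1}$ ($N$ terms, the last one being $\Lambda$). $\varphi(z)=(z;q)_\infty=\prod_{n\ge0}(1-zq^n)$, and $\frac{(q^\alpha x;q)_\infty}{(x;q)_\infty}=\sum_{k\ge0}\frac{(q^\alpha;q)_k}{(q;q)_k}x^k$ by the $q$-binomial theorem, which is how the ratios are expanded as $h\to0$. The normal ordering $:F(x,\vartheta):$ of a function $F(x,\theta)$ of commuting variables is the linear operator on formal power series with $:F(x,\vartheta):x^\nu=F(x,\nu)x^\nu$ on monomials $x^\nu=\prod_a x_a^{\nu_a}$. Hamiltonian (parameters $b_i,d_i,\overline{d}_i,q,\kappa$): $\mathcal{H}=q^{\frac12\Delta}\mathcal{A}_L\mathcal{A}_C\mathcal{A}_R\,q^{\frac12\Delta}\,\mathsf{T}$, where $\Delta=\sum_{i=1}^N(\vartheta_i^2-\vartheta_i\vartheta_{i-1})$, $\mathsf{T}$ is the shift $x_i\mapsto\frac{\kappa b_i}{b_{i+1}}x_i$ for all $i$, $\mathcal{A}_C=\prod_{i=1}^N\frac{1}{\varphi(d_ix_i)\varphi(\overline{d}_ix_i)}$, $\mathcal{A}_L^{-1}=\ :\prod_{i=1}^N\frac{1}{\varphi(x_iq^{-\vartheta'_i})}:$, $\mathcal{A}_R=\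 :\prod_{i=1}^N\varphi(d_i\overline{d}_ix_iq^{\vartheta'_i}):$. Affine Laumon partition function: for parameters $a_i,b_i,c_i$ and variables $\mathsf{x}_i$ ($1\le i\le N$), $$\mathcal{Z}=\sum_{\vec\lambda}\prod_{i,j=1}^N\frac{\mathsf{N}^{(j-i)}_{\emptyset,\lambda^{(j)}}(a_i/b_j)\,\mathsf{N}^{(j-i)}_{\lambda^{(i)},\emptyset}(b_i/c_j)}{\mathsf{N}^{(j-i)}_{\lambda^{(i)},\lambda^{(j)}}(b_i/b_j)}\prod_{i=1}^N\mathsf{x}_i^{k_i(\vec\lambda)},$$ summed over $N$-tuples of partitions $\vec\lambda=(\lambda^{(1)},\dots,\lambda^{(N)})$, with $$\mathsf{N}^{(k)}_{\lambda,\mu}(u)=\prod_{\substack{j\ge i\ge1\\ j-i\equiv k}}[uq^{-\mu_i+\lambda_{j+1}}\kappa^{-i+j};q]_{\lambda_j-\lambda_{j+1}}\prod_{\substack{\beta\ge\alpha\ge1\\ \beta-\alpha\equiv-k-1}}[uq^{\lambda_\alpha-\mu_\beta}\kappa^{\alpha-\beta-1};q]_{\mu_\beta-\mu_{\beta+1}}$$ (congruences modulo $N$), $[u;q]_n=u^{-n/2}q^{-n(n-1)/4}\prod_{l=0}^{n-1}(1-uq^l)$, and $k_i(\vec\lambda)=\sum_{\alpha+\beta\equiv i+1}\sum_{k\in\mathbb{Z}}\lambda^{(\alpha)}_{\beta+Nk}$ ($\alpha,\beta\in\mathbb{Z}/N\mathbb{Z}$; $\lambda^{(\alpha)}_l=0$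 for $l\le0$). In the conjecture, $\psi$ is $\mathcal{Z}$ with $a_i=q\kappa b_{i-1}/d_{i-1}$ (where $b_0=b_N$, $d_0=d_N$), $c_i=b_i/\overline{d}_i$ and $\mathsf{x}_i=\sqrt{\frac{b_{i+1}d_i\overline{d}_i}{q\kappa b_i}}\,x_i$; it is a power series in $x_1,\dots,x_N$ with constant term $1$. Normalization of $\psi_{5d}$: $\psi_{5d}$ is $q^{\frac12\Delta}\psi$ with each $x_a$ replaced by $x_a/d_a$. With this, $\mathcal{H}\psi=\psi$, rewritten as $\mathcal{A}_L^{-1}q^{-\frac12\Delta}\psi=\mathcal{A}_C\mathcal{A}_Rq^{\frac12\Delta}\mathsf{T}\psi$, becomes $(A_1-A_2)\psi_{5d}=0$. *)

theory Defs
  imports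
    "HOL-Complex_Analysis.Complex_Analysis"
    "Berlekamp_Zassenhaus.Finite_Field"
begin

text \<open>
  Indices live in \<open>'n mod_ring\<close>, that is, in \<open>\<int>/N\<int>\<close> with \<open>N = CARD('n) \<ge> 1\<close>.  The class of an
  integer is written with \<open>of_int_mod_ring\<close>, because the numeral \<open>1\<close> of \<open>'n mod_ring\<close> is only
  available for \<open>N \<ge> 2\<close>.

  All nonzero scalars are written as \<open>q\<^sup>s = exp (h s)\<close> with \<open>q = exp h\<close>.  For \<open>h \<noteq> 0\<close> every nonzero
  complex number is of this form, and working with the exponent \<open>s\<close> fixes all the square roots
  that occur (in \<open>[u;q]\<^sub>n\<close>, \<open>q\<^bsup>\<Delta>/2\<^esup>\<close> and the rescaling of the variables) in a consistent way.
  Throughout: \<open>\<kappa> = q\<^sup>k\<close>, \<open>a\<^sub>i = q\<^bsup>\<alpha> i\<^esup>\<close>, \<open>b\<^sub>i = q\<^bsup>\<beta> i\<^esup>\<close>, \<open>c\<^sub>i = q\<^bsup>\<sigma> i\<^esup>\<close>, \<open>d\<^sub>i = q\<^bsup>m i\<^esup>\<close>, and the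
  conjugate parameter of \<open>d\<^sub>i\<close> is \<open>q\<^bsup>mt i\<^esup>\<close>.
\<close>

definition qp :: "complex \<Rightarrow> complex \<Rightarrow> complex" where
  "qp h s = exp (h * s)"

definition nxt :: "'n::finite mod_ring \<Rightarrow> 'n mod_ring" where
  "nxt a = a + of_int_mod_ring 1"

definition prv :: "'n::finite mod_ring \<Rightarrow> 'n mod_ring" where
  "prv a = a - of_int_mod_ring 1"


section \<open>Formal power series in \<open>x\<^sub>a\<close>, \<open>a \<in> \<int>/N\<int>\<close>, and operators on them\<close>

text \<open>A series is its family of coefficients, indexed by the exponent of the monomial.\<close>

type_synonym 'n expo = "'n mod_ring \<Rightarrow> nat"
type_synonym 'n mseries = "'n expo \<Rightarrow> complex"

definition mmult :: "'n::finite mseries \<Rightarrow> 'n mseries \<Rightarrow> 'n mseries" where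
  "mmult f g = (\<lambda>\<mu>. \<Sum>\<nu> | \<forall>a. \<nu> a \<le> \<mu> a. f \<nu> * g (\<lambda>a. \<mu> a - \<nu> a))"

text \<open>The product over all \<open>a\<close> of the one-variable series \<open>g a\<close>, evaluated at \<open>x\<^sub>a\<close>.\<close>

definition prod_series :: "('n::finite mod_ring \<Rightarrow> complex fps) \<Rightarrow> 'n mseries" where
  "prod_series g = (\<lambda>\<mu>. \<Prod>a\<in>UNIV. fps_nth (g a) (\<mu> a))"

text \<open>\<open>:F(x,\<theta>):\<close>, where \<open>F \<nu>\<close> is the power series \<open>F(x,\<nu>)\<close>: it sends \<open>x\<^sup>\<nu>\<close> to \<open>F(x,\<nu>) x\<^sup>\<nu>\<close>.\<close>

definition normal_order :: "('n::finite expo \<Rightarrow> 'n mseries) \<Rightarrow> 'n mseries \<Rightarrow> 'n mseries" where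
  "normal_order F f = (\<lambda>\<mu>. \<Sum>\<nu> | \<forall>a. \<nu> a \<le> \<mu> a. f \<nu> * F \<nu> (\<lambda>a. \<mu> a - \<nu> a))"

text \<open>The substitution \<open>x\<^sub>a \<mapsto> c\<^sub>a x\<^sub>a\<close>.\<close>

definition rescale :: "('n::finite mod_ring \<Rightarrow> complex) \<Rightarrow> 'n mseries \<Rightarrow> 'n mseries" where
  "rescale c f = (\<lambda>\<nu>. (\<Prod>a\<in>UNIV. c a ^ \<nu> a) * f \<nu>)"

definition theta :: "'n::finite mod_ring \<Rightarrow> 'n mseries \<Rightarrow> 'n mseries" where
  "theta a f = (\<lambda>\<nu>. of_nat (\<nu> a) * f \<nu>)"

definition theta' :: "'n::finite mod_ring \<Rightarrow> 'n mseries \<Rightarrow> 'n mseries" where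
  "theta' a f = (\<lambda>\<nu>. theta a f \<nu> - theta (prv a) f \<nu>)"

text \<open>The operator \<open>c + \<theta>'\<^sub>a\<close>.\<close>

definition add_theta' :: "complex \<Rightarrow> 'n::finite mod_ring \<Rightarrow> 'n mseries \<Rightarrow> 'n mseries" where
  "add_theta' c a f = (\<lambda>\<nu>. c * f \<nu> + theta' a f \<nu>)"

text \<open>Eigenvalues of \<open>\<theta>'\<^sub>a\<close> and of \<open>\<Delta>\<close> on the monomial \<open>x\<^sup>\<nu>\<close>.\<close>

definition ev' :: "'n::finite expo \<Rightarrow> 'n mod_ring \<Rightarrow> complex" where
  "ev' \<nu> a = of_nat (\<nu> a) - of_nat (\<nu> (prv a))"

definition evDelta :: "'n::finite expo \<Rightarrow> complex" where
  "evDelta \<nu> = (\<Sum>a\<in>UNIV. of_nat (\<nu> a) ^ 2 - of_nat (\<nu> a) * of_nat (\<nu> (prv a)))"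

definition q_half_Delta :: "complex \<Rightarrow> 'n::finite mseries \<Rightarrow> 'n mseries" where
  "q_half_Delta h f = (\<lambda>\<nu>. qp h (evDelta \<nu> / 2) * f \<nu>)"

definition U :: "'n::finite mod_ring \<Rightarrow> 'n mseries" where
  "U a = (\<lambda>\<mu>. \<Sum>r = 1..CARD('n).
     if \<mu> = (\<lambda>b. card {s. s < r \<and> a + of_int_mod_ring (int s) = b}) then 1 else 0)"

text \<open>\<open>1 / (1 - \<Lambda>) = \<Sum>n. \<Lambda>\<^sup>n\<close>, where \<open>\<Lambda>\<^sup>n\<close> is the monomial all of whose exponents are \<open>n\<close>.\<close>

definition inverse_1_Lambda :: "'n::finite mseries" where
  "inverse_1_Lambda = (\<lambda>\<mu>. if \<exists>n. \<mu> = (\<lambda>_. n) then 1 else 0)"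


section \<open>The Hamiltonian\<close>

definition phi :: "complex \<Rightarrow> complex \<Rightarrow> complex" where
  "phi q z = (\<Prod>n. 1 - z * q ^ n)"

text \<open>\<open>\<phi>(c x)\<close> as a power series in \<open>x\<close>, with \<open>q = exp h\<close>; meaningful for \<open>Re h < 0\<close>, that is, \<open>|q| < 1\<close>.\<close>

definition phi_fps :: "complex \<Rightarrow> complex \<Rightarrow> complex fps" where
  "phi_fps h c = fps_expansion (\<lambda>x. phi (qp h 1) (c * x)) 0"

definition A_C :: "complex \<Rightarrow> ('n::finite mod_ring \<Rightarrow> complex) \<Rightarrow> ('n mod_ring \<Rightarrow> complex)
    \<Rightarrow> 'n mseries \<Rightarrow> 'n mseries" where
  "A_C h m mt = mmult (prod_series (\<lambda>i. 1 / (phi_fps h (qp h (m i)) * phi_fps h (qp h (mt i)))))"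

definition A_L_inv :: "complex \<Rightarrow> 'n::finite mseries \<Rightarrow> 'n mseries" where
  "A_L_inv h = normal_order (\<lambda>\<nu>. prod_series (\<lambda>i. 1 / phi_fps h (qp h (- ev' \<nu> i))))"

text \<open>\<open>A_L_inv\<close> is bijective, being the identity plus an operator that raises the total degree.\<close>

definition A_L :: "complex \<Rightarrow> 'n::finite mseries \<Rightarrow> 'n mseries" where
  "A_L h = inv_into UNIV (A_L_inv h)"

definition A_R :: "complex \<Rightarrow> ('n::finite mod_ring \<Rightarrow> complex) \<Rightarrow> ('n mod_ring \<Rightarrow> complex)
    \<Rightarrow> 'n mseries \<Rightarrow> 'n mseries" where
  "A_R h m mt = normal_order (\<lambda>\<nu>. prod_series (\<lambda>i.
     phi_fps h (qp h (m i) * qp h (mt i) * qp h (ev' \<nu> i))))"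

definition shift_T :: "complex \<Rightarrow> complex \<Rightarrow> ('n::finite mod_ring \<Rightarrow> complex)
    \<Rightarrow> 'n mseries \<Rightarrow> 'n mseries" where
  "shift_T h k \<beta> = rescale (\<lambda>i. qp h k * qp h (\<beta> i) / qp h (\<beta> (nxt i)))"

definition hamiltonian :: "complex \<Rightarrow> complex \<Rightarrow> ('n::finite mod_ring \<Rightarrow> complex)
    \<Rightarrow> ('n mod_ring \<Rightarrow> complex) \<Rightarrow> ('n mod_ring \<Rightarrow> complex) \<Rightarrow> 'n mseries \<Rightarrow> 'n mseries" where
  "hamiltonian h k \<beta> m mt =
     q_half_Delta h \<circ> A_L h \<circ> A_C h m mt \<circ> A_R h m mt \<circ> q_half_Delta h \<circ> shift_T h k \<beta>"


section \<open>The affine Laumon partition function\<close>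

text \<open>Partitions have parts \<open>lam 1 \<ge> lam 2 \<ge> \<dots>\<close>; the unused entry \<open>lam 0\<close> is \<open>0\<close>.\<close>

definition is_partition :: "(nat \<Rightarrow> nat) \<Rightarrow> bool" where
  "is_partition lam \<longleftrightarrow>
     lam 0 = 0 \<and> (\<forall>i\<ge>1. lam (Suc i) \<le> lam i) \<and> finite {i. lam i \<noteq> 0}"

text \<open>\<open>[u;q]\<^sub>n\<close> for \<open>u = q\<^sup>s\<close>.\<close>

definition qbracket :: "complex \<Rightarrow> complex \<Rightarrow> nat \<Rightarrow> complex" where
  "qbracket h s n = qp h (- (s * of_nat n / 2)) * qp h (- (of_nat n * (of_nat n - 1) / 4))
     * (\<Prod>l<n. 1 - qp h s * qp h 1 ^ l)"

text \<open>
  The factor \<open>N\<close> with upper index \<open>r\<close>, at \<open>u = q\<^sup>s\<close>.  The conditions \<open>lam j \<noteq> 0\<close> and \<open>mu b \<noteq> 0\<close>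
  only omit factors of the form \<open>[\<dots>;q]\<^sub>0 = 1\<close>; they make the index sets finite.
\<close>

definition Nek :: "complex \<Rightarrow> complex \<Rightarrow> 'n::finite mod_ring \<Rightarrow> (nat \<Rightarrow> nat) \<Rightarrow> (nat \<Rightarrow> nat)
    \<Rightarrow> complex \<Rightarrow> complex" where
  "Nek h k r lam mu s =
     (\<Prod>(i, j) | 1 \<le> i \<and> i \<le> j \<and> lam j \<noteq> 0 \<and> of_int_mod_ring (int j - int i) = r.
        qbracket h (s - of_nat (mu i) + of_nat (lam (Suc j)) + k * (of_nat j - of_nat i))
          (lam j - lam (Suc j))) *
     (\<Prod>(a, b) | 1 \<le> a \<and> a \<le> b \<and> mu b \<noteq> 0 \<and> of_int_mod_ring (int b - int a) = - r - of_int_mod_ring 1.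
        qbracket h (s + of_nat (lam a) - of_nat (mu b) + k * (of_nat a - of_nat b - 1))
          (mu b - mu (Suc b)))"

definition box_count :: "('n::finite mod_ring \<Rightarrow> nat \<Rightarrow> nat) \<Rightarrow> 'n expo" where
  "box_count lam i = (\<Sum>a\<in>UNIV. \<Sum>l | lam a l \<noteq> 0 \<and> a + of_int_mod_ring (int l) = nxt i. lam a l)"

definition laumon_Z :: "complex \<Rightarrow> complex \<Rightarrow> ('n::finite mod_ring \<Rightarrow> complex)
    \<Rightarrow> ('n mod_ring \<Rightarrow> complex) \<Rightarrow> ('n mod_ring \<Rightarrow> complex) \<Rightarrow> 'n mseries" where
  "laumon_Z h k \<alpha> \<beta> \<sigma> = (\<lambda>\<nu>. \<Sum>lam | (\<forall>i. is_partition (lam i)) \<and> box_count lam = \<nu>.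
     \<Prod>i\<in>UNIV. \<Prod>j\<in>UNIV.
       Nek h k (j - i) (\<lambda>_. 0) (lam j) (\<alpha> i - \<beta> j) * Nek h k (j - i) (lam i) (\<lambda>_. 0) (\<beta> i - \<sigma> j)
         / Nek h k (j - i) (lam i) (lam j) (\<beta> i - \<beta> j))"

definition psi :: "complex \<Rightarrow> complex \<Rightarrow> ('n::finite mod_ring \<Rightarrow> complex)
    \<Rightarrow> ('n mod_ring \<Rightarrow> complex) \<Rightarrow> ('n mod_ring \<Rightarrow> complex) \<Rightarrow> 'n mseries" where
  "psi h k \<beta> m mt = rescale (\<lambda>i. qp h ((\<beta> (nxt i) + m i + mt i - 1 - k - \<beta> i) / 2))
     (laumon_Z h k (\<lambda>i. 1 + k + \<beta> (prv i) - m (prv i)) \<beta> (\<lambda>i. \<beta> i - mt i))"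

text \<open>
  The values of \<open>h\<close> with \<open>|q| < 1\<close> for which no denominator of the partition function vanishes.
  Each denominator is, up to a nonzero scalar, a product of factors \<open>1 - exp (h s)\<close> with exponents \<open>s\<close>
  depending only on \<open>k\<close> and \<open>\<beta>\<close>.  If no \<open>s\<close> is \<open>0\<close>, then only countably many \<open>h\<close> are excluded and
  \<open>0\<close> is a limit point of the set; if some \<open>s\<close> is \<open>0\<close>, the set is empty.
\<close>

definition admissible :: "complex \<Rightarrow> ('n::finite mod_ring \<Rightarrow> complex) \<Rightarrow> complex set" where
  "admissible k \<beta> = {h. Re h < 0 \<and>
     (\<forall>lam i j. (\<forall>i. is_partition (lam i)) \<longrightarrow>
        Nek h k (j - i) (lam i) (lam j) (\<beta> i - \<beta> j) \<noteq> 0)}"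

definition laumon_conjecture :: "'n::finite itself \<Rightarrow> bool" where
  "laumon_conjecture _ \<longleftrightarrow>
     (\<forall>h k (\<beta> :: 'n mod_ring \<Rightarrow> complex) m mt. h \<in> admissible k \<beta> \<longrightarrow>
        hamiltonian h k \<beta> m mt (psi h k \<beta> m mt) = psi h k \<beta> m mt)"


section \<open>The five-dimensional function, its equation, and the limit \<open>h \<rightarrow> 0\<close>\<close>

definition psi5d :: "complex \<Rightarrow> complex \<Rightarrow> ('n::finite mod_ring \<Rightarrow> complex)
    \<Rightarrow> ('n mod_ring \<Rightarrow> complex) \<Rightarrow> ('n mod_ring \<Rightarrow> complex) \<Rightarrow> 'n mseries" where
  "psi5d h k \<beta> m mt = rescale (\<lambda>a. 1 / qp h (m a)) (q_half_Delta h (psi h k \<beta> m mt))"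

definition A1 :: "complex \<Rightarrow> ('n::finite mod_ring \<Rightarrow> complex) \<Rightarrow> ('n mod_ring \<Rightarrow> complex)
    \<Rightarrow> 'n mseries \<Rightarrow> 'n mseries" where
  "A1 h \<gamma> mt = normal_order (\<lambda>\<nu>. prod_series (\<lambda>a.
     phi_fps h (qp h (ev' \<nu> a + mt a)) / phi_fps h 1
       * fps_const (qp h (\<gamma> a * of_nat (\<nu> a)))))"

definition A2 :: "complex \<Rightarrow> ('n::finite mod_ring \<Rightarrow> complex) \<Rightarrow> ('n mod_ring \<Rightarrow> complex)
    \<Rightarrow> 'n mseries \<Rightarrow> 'n mseries" where
  "A2 h m mt = normal_order (\<lambda>\<nu>. prod_series (\<lambda>a.
     phi_fps h (qp h (mt a - m a)) / phi_fps h (qp h (- ev' \<nu> a - m a))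
       * fps_const (qp h (- of_nat (\<nu> a) * ev' \<nu> a))))"

text \<open>Coefficientwise limit; \<open>h\<close> approaches \<open>0\<close> through the values for which \<open>psi5d\<close> is defined.\<close>

definition psi4d :: "complex \<Rightarrow> ('n::finite mod_ring \<Rightarrow> complex)
    \<Rightarrow> ('n mod_ring \<Rightarrow> complex) \<Rightarrow> ('n mod_ring \<Rightarrow> complex) \<Rightarrow> 'n mseries" where
  "psi4d k \<beta> m mt = (\<lambda>\<nu>. Lim (at 0 within admissible k \<beta>) (\<lambda>h. psi5d h k \<beta> m mt \<nu>))"

definition equation_4d :: "('n::finite mod_ring \<Rightarrow> complex) \<Rightarrow> ('n mod_ring \<Rightarrow> complex)
    \<Rightarrow> ('n mod_ring \<Rightarrow> complex) \<Rightarrow> 'n mseries \<Rightarrow> bool" where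
  "equation_4d \<gamma> m mt f \<longleftrightarrow> (\<forall>\<mu>.
     (\<Sum>a\<in>UNIV. theta a (add_theta' (\<gamma> a) a f) \<mu>
        + mmult (mmult (U a) inverse_1_Lambda)
            (add_theta' (m a) a (add_theta' (mt a) a f)) \<mu>) = 0)"

end

theory Submission
  imports Defs
begin

text \<open>
  At \<open>h = 0\<close> the operators \<open>A\<^sub>1\<close> and \<open>A\<^sub>2\<close> both become
  \<open>L = :\<Prod>\<^sub>a (1 - x\<^sub>a)\<^bsup>-\<theta>'\<^sub>a - mt\<^sub>a\<^esup>:\<close>, so the equation for \<open>\<psi>\<^bsub>4d\<^esub>\<close> is the first order in \<open>h\<close>:
  \<open>:L \<Sum>\<^sub>a (\<theta>\<^sub>a (\<theta>'\<^sub>a + \<gamma>\<^sub>a) + x\<^sub>a / (1 - x\<^sub>a) (m\<^sub>a + \<theta>'\<^sub>a) (mt\<^sub>a + \<theta>'\<^sub>a)):\<close> annihilates \<open>\<psi>\<^bsub>4d\<^esub>\<close>.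
  Moving \<open>L\<close> out to the left of the normal ordering substitutes \<open>x\<^sub>a (1 - x\<^bsub>a+1\<^esub>) / (1 - x\<^sub>a)\<close> for
  \<open>x\<^sub>a\<close>.  This substitution fixes \<open>\<Lambda>\<close> and, by a telescoping sum, turns \<open>U\<^sub>a / (1 - \<Lambda>)\<close> into
  \<open>x\<^sub>a / (1 - x\<^sub>a)\<close>.  Since \<open>L\<close> is triangular with respect to the degree, it can be cancelled.
\<close>

section \<open>The series of \<open>\<phi>\<close> and the \<open>q\<close>-binomial theorem\<close>

lemma norm_qp_less_1: "Re h < 0 \<Longrightarrow> norm (qp h 1) < 1"
  by (simp add: qp_def)

lemma qp_add: "qp h (s + t) = qp h s * qp h t"
  by (simp add: qp_def algebra_simps exp_add)

lemma qp_minus: "qp h (- s) = 1 / qp h s"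
  by (simp add: qp_def exp_minus field_simps)

lemma qp_diff: "qp h (s - t) = qp h s / qp h t"
  by (simp add: qp_def algebra_simps exp_diff)

lemma qp_nonzero [simp]: "qp h s \<noteq> 0"
  by (simp add: qp_def)

lemma qp_0 [simp]: "qp h 0 = 1"
  by (simp add: qp_def)

lemma qp_power: "qp h s ^ n = qp h (of_nat n * s)"
  by (simp add: qp_def exp_of_nat_mult[symmetric] algebra_simps)

lemma qp_1_power_neq_1:
  assumes "Re h < 0" "n > 0"
  shows "qp h 1 ^ n \<noteq> 1"
proof
  assume "qp h 1 ^ n = 1"
  then have "norm (qp h 1) ^ n = 1"
    by (metis norm_one norm_power)
  with norm_qp_less_1[OF assms(1)] assms(2) show False
    by (metis norm_ge_zero power_less_one_iff order_less_irrefl)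
qed

section \<open>The infinite product as an entire function\<close>

lemma phi_convergent:
  fixes q z :: complex
  assumes "norm q < 1"
  shows "convergent_prod (\<lambda>n. 1 - z * q ^ n)"
proof -
  have "summable (\<lambda>n. norm ((1 - z * q ^ n) - 1))"
    using assms by (simp add: norm_mult norm_power summable_mult summable_geometric)
  then show ?thesis
    by (intro abs_convergent_prod_imp_convergent_prod)
       (simp only: abs_convergent_prod_conv_summable)
qed

text \<open>On the closed disc of radius 1 about x the majorant (|x| + 1) |q|^n makes the partial
  products converge uniformly, so \<open>phi q\<close> is entire.\<close>

lemma phi_holomorphic:
  assumes "norm q < 1"
  shows "phi q holomorphic_on UNIV"
proof (rule holomorphic_uniform_sequence)
  show "open (UNIV :: complex set)" by simp
  show "(\<lambda>z. \<Prod>n<N. 1 - z * q ^ n) holomorphic_on UNIV" for N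
    by (intro holomorphic_intros)
  show "\<exists>d>0. cball x d \<subseteq> UNIV \<and>
      uniform_limit (cball x d) (\<lambda>N z. \<Prod>n<N. 1 - z * q ^ n) (phi q) sequentially" for x
  proof (intro exI conjI)
    let ?A = "cball x 1"
    have "uniformly_convergent_on ?A (\<lambda>N z. \<Sum>n<N. norm (- z * q ^ n))"
    proof (rule Weierstrass_m_test'_ev)
      have "norm (norm (- z * q ^ n)) \<le> (norm x + 1) * norm q ^ n" if "z \<in> ?A" for z n
      proof -
        have "norm z \<le> norm x + 1"
          using that norm_triangle_ineq2[of z x] by (simp add: dist_norm norm_minus_commute)
        then show ?thesis
          by (simp add: norm_mult norm_power mult_right_mono)
      qed
      then show "\<forall>\<^sub>F n in sequentially. \<forall>z\<in>?A. norm (norm (- z * q ^ n)) \<le> (norm x + 1) * norm q ^ n"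
        by auto
      show "summable (\<lambda>n. (norm x + 1) * norm q ^ n)"
        using assms by (simp add: summable_mult summable_geometric)
    qed
    then have "uniformly_convergent_on ?A (\<lambda>N z. \<Prod>n<N. 1 + (- z * q ^ n))"
      by (intro uniformly_convergent_on_prod continuous_intros) auto
    then obtain g where g: "uniform_limit ?A (\<lambda>N z. \<Prod>n<N. 1 + (- z * q ^ n)) g sequentially"
      by (auto simp: uniformly_convergent_on_def)
    have "g z = phi q z" if "z \<in> ?A" for z
    proof -
      have "(\<lambda>N. \<Prod>n<N. 1 - z * q ^ n) \<longlonglongrightarrow> g z"
        using tendsto_uniform_limitI[OF g that] by simp
      moreover have "(\<lambda>N. \<Prod>n<N. 1 - z * q ^ n) \<longlonglongrightarrow> phi q z"
        using convergent_prod_LIMSEQ[OF phi_convergent[OF assms, of z]]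
        unfolding phi_def by (subst (asm) LIMSEQ_lessThan_iff_atMost[symmetric]) simp
      ultimately show ?thesis
        by (rule LIMSEQ_unique)
    qed
    with g show "uniform_limit ?A (\<lambda>N z. \<Prod>n<N. 1 - z * q ^ n) (phi q) sequentially"
      by (auto simp: uniform_limit_iff)
  qed auto
qed

lemma phi_0 [simp]: "phi q 0 = 1"
  by (simp add: phi_def)

lemma phi_functional_equation:
  assumes "norm q < 1"
  shows "phi q z = (1 - z) * phi q (q * z)"
proof (rule LIMSEQ_unique)
  have lim: "(\<lambda>N. \<Prod>n\<le>N. 1 - w * q ^ n) \<longlonglongrightarrow> phi q w" for w
    using convergent_prod_LIMSEQ[OF phi_convergent[OF assms, of w]] by (simp add: phi_def)
  show "(\<lambda>N. \<Prod>n\<le>Suc N. 1 - z * q ^ n) \<longlonglongrightarrow> phi q z"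
    using lim[of z] by (rule LIMSEQ_Suc)
  have "(\<Prod>n\<le>Suc N. 1 - z * q ^ n) = (1 - z) * (\<Prod>n\<le>N. 1 - q * z * q ^ n)" for N
    by (subst prod.atMost_Suc_shift) (simp add: mult_ac)
  then show "(\<lambda>N. \<Prod>n\<le>Suc N. 1 - z * q ^ n) \<longlonglongrightarrow> (1 - z) * phi q (q * z)"
    using tendsto_mult_left[OF lim[of "q * z"], of "1 - z"] by simp
qed

section \<open>Power series of \<open>phi\<close> and of its ratios\<close>

lemma phi_fps_expansion:
  assumes "Re h < 0"
  shows "(\<lambda>x. phi (qp h 1) (c * x)) has_fps_expansion phi_fps h c"
proof -
  have "(\<lambda>x. phi (qp h 1) (c * x)) holomorphic_on UNIV"
    using holomorphic_on_compose_gen[of "\<lambda>x. c * x" UNIV "phi (qp h 1)" UNIV]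
      phi_holomorphic[OF norm_qp_less_1[OF assms]]
    by (auto simp: o_def intro!: holomorphic_intros)
  then show ?thesis
    unfolding phi_fps_def
    by (intro has_fps_expansion_fps_expansion[of UNIV]) auto
qed

lemma phi_fps_scale:
  assumes "Re h < 0"
  shows "phi_fps h (a * c) = phi_fps h a oo (fps_const c * fps_X)"
proof -
  have "((\<lambda>x. phi (qp h 1) (a * x)) \<circ> (\<lambda>x. c * x)) has_fps_expansion
      (phi_fps h a oo (fps_const c * fps_X))"
    by (intro has_fps_expansion_compose phi_fps_expansion assms fps_expansion_intros) auto
  then have "(\<lambda>x. phi (qp h 1) (a * c * x)) has_fps_expansion
      (phi_fps h a oo (fps_const c * fps_X))"
    by (simp add: o_def mult.assoc)
  then show ?thesis
    using phi_fps_expansion[OF assms, of "a * c"] fps_expansion_unique_complex by blast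
qed

lemma phi_fps_0 [simp]:
  assumes "Re h < 0"
  shows "fps_nth (phi_fps h c) 0 = 1"
  using has_fps_expansion_imp_0_eq_fps_nth_0[OF phi_fps_expansion[OF assms, of c]] by simp

lemma phi_fps_nonzero: "Re h < 0 \<Longrightarrow> phi_fps h c \<noteq> 0"
  by (metis phi_fps_0 fps_zero_nth zero_neq_one)

lemma phi_fps_functional_equation:
  assumes "Re h < 0"
  shows "phi_fps h c = (1 - fps_const c * fps_X) * phi_fps h (qp h 1 * c)"
proof -
  have "(\<lambda>x. (1 - c * x) * phi (qp h 1) (qp h 1 * c * x)) has_fps_expansion
      (1 - fps_const c * fps_X) * phi_fps h (qp h 1 * c)"
    by (intro fps_expansion_intros phi_fps_expansion assms)
  also have "(\<lambda>x. (1 - c * x) * phi (qp h 1) (qp h 1 * c * x)) = (\<lambda>x. phi (qp h 1) (c * x))"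
    using phi_functional_equation[OF norm_qp_less_1[OF assms]] by (metis (no_types) mult.assoc)
  finally show ?thesis
    using phi_fps_expansion[OF assms, of c] fps_expansion_unique_complex by blast
qed

text \<open>Brings the ratios in \<open>A2\<close> to the denominator \<open>phi_fps h 1\<close>,
  where the q-binomial theorem applies. The constant terms are 1, so the quotients are genuine and
  composition passes through the division.\<close>

lemma phi_fps_ratio_scale:
  assumes "Re h < 0"
  shows "phi_fps h (a * c) / phi_fps h (b * c) = (phi_fps h a / phi_fps h b) oo (fps_const c * fps_X)"
proof -
  have "phi_fps h b dvd phi_fps h a"
    using assms by (simp add: fps_dvd_iff phi_fps_nonzero subdegree_eq_0)
  moreover have "phi_fps h b oo (fps_const c * fps_X) \<noteq> 0"
    unfolding phi_fps_scale[OF assms, symmetric] using assms by (rule phi_fps_nonzero)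
  ultimately show ?thesis
    unfolding phi_fps_scale[OF assms] by (simp add: fps_compose_divide_distrib)
qed

text \<open>In q-Pochhammer notation this is (q^s;q)_n / (q;q)_n.\<close>

definition qbin :: "complex \<Rightarrow> complex \<Rightarrow> nat \<Rightarrow> complex" where
  "qbin h s n = (\<Prod>l<n. (1 - qp h (s + of_nat l)) / (1 - qp h (of_nat (Suc l))))"

text \<open>The \<open>q\<close>-binomial theorem: the recursion for the coefficients of the ratio \<open>R\<close> is read off from
  \<open>(1 - x) R(x) = (1 - q\<^sup>s x) R(q x)\<close>.\<close>
lemma phi_fps_ratio_nth:
  assumes "Re h < 0"
  shows "fps_nth (phi_fps h (qp h s) / phi_fps h 1) n = qbin h s n"
proof (induction n)
  case 0
  then show ?case
    using assms by (simp add: fps_divide_unit qbin_def)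
next
  case (Suc n)
  define R where "R = phi_fps h (qp h s) / phi_fps h 1"
  let ?q = "qp h 1"
  have u: "fps_nth (phi_fps h c) 0 \<noteq> 0" for c
    using assms by simp
  have unit: "is_unit (phi_fps h c)" for c
    using u by simp
  have R1: "R * phi_fps h 1 = phi_fps h (qp h s)"
    using unit by (simp add: R_def)
  have Rq: "(R oo (fps_const ?q * fps_X)) * phi_fps h ?q = phi_fps h (?q * qp h s)"
  proof -
    have "R oo (fps_const ?q * fps_X) = phi_fps h (?q * qp h s) / phi_fps h ?q"
      using phi_fps_ratio_scale[OF assms, of "qp h s" ?q 1] by (simp add: R_def mult.commute)
    then show ?thesis using unit by simp
  qed
  have "phi_fps h ?q * ((1 - fps_X) * R) = phi_fps h (qp h s)"
    using R1 phi_fps_functional_equation[OF assms, of 1] by (simp add: mult_ac)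
  also have "\<dots> = (1 - fps_const (qp h s) * fps_X) * phi_fps h (?q * qp h s)"
    by (rule phi_fps_functional_equation[OF assms])
  also have "\<dots> = phi_fps h ?q * ((1 - fps_const (qp h s) * fps_X) * (R oo (fps_const ?q * fps_X)))"
    using Rq by (simp add: mult_ac)
  finally have "(1 - fps_X) * R = (1 - fps_const (qp h s) * fps_X) * (R oo (fps_const ?q * fps_X))"
    using phi_fps_nonzero[OF assms] by simp
  then have "fps_nth ((1 - fps_X) * R) (Suc n)
      = fps_nth ((1 - fps_const (qp h s) * fps_X) * (R oo (fps_const ?q * fps_X))) (Suc n)"
    by simp
  then have "fps_nth R (Suc n) - fps_nth R n
      = ?q ^ Suc n * fps_nth R (Suc n) - qp h s * (?q ^ n * fps_nth R n)"
    by (simp add: left_diff_distrib fps_compose_linear mult.assoc)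
  then have "fps_nth R (Suc n) * (1 - ?q ^ Suc n) = fps_nth R n * (1 - qp h (s + of_nat n))"
    by (simp add: qp_add qp_power algebra_simps)
  moreover have "1 - ?q ^ Suc n \<noteq> 0"
    using qp_1_power_neq_1[OF assms, of "Suc n"] by simp
  ultimately have "fps_nth R (Suc n) = fps_nth R n * ((1 - qp h (s + of_nat n)) / (1 - ?q ^ Suc n))"
    by (simp add: field_simps)
  moreover have "?q ^ Suc n = qp h (of_nat (Suc n))"
    by (simp only: qp_power mult_1_right)
  ultimately have "fps_nth R (Suc n)
      = qbin h s n * ((1 - qp h (s + of_nat n)) / (1 - qp h (of_nat (Suc n))))"
    using Suc by (simp add: R_def)
  then show ?case
    unfolding R_def by (simp add: qbin_def)
qed

section \<open>Normally ordered operators\<close>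

abbreviation below :: "'n::finite expo \<Rightarrow> 'n expo set" where
  "below \<mu> \<equiv> {\<nu>. \<forall>a. \<nu> a \<le> \<mu> a}"

lemma below_eq_PiE: "below \<mu> = (\<Pi>\<^sub>E a\<in>UNIV. {..\<mu> a})"
  by (auto simp: PiE_iff)

lemma finite_below [simp]: "finite (below \<mu>)"
  unfolding below_eq_PiE by (intro finite_PiE) auto

text \<open>Both sides run over the pairs with \<tau> + \<nu> \<le> \<mu>.\<close>

lemma sum_below_commute:
  fixes g :: "'n::finite expo \<Rightarrow> 'n expo \<Rightarrow> 'b::comm_monoid_add"
  shows "(\<Sum>\<tau>\<in>below \<mu>. \<Sum>\<nu>\<in>below (\<lambda>a. \<mu> a - \<tau> a). g \<tau> \<nu>)
    = (\<Sum>\<nu>\<in>below \<mu>. \<Sum>\<tau>\<in>below (\<lambda>a. \<mu> a - \<nu> a). g \<tau> \<nu>)"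
proof -
  have swap: "y \<in> below \<mu> \<and> x \<in> below (\<lambda>a. \<mu> a - y a)"
    if "x \<in> below \<mu>" "y \<in> below (\<lambda>a. \<mu> a - x a)" for x y :: "'n expo"
  proof -
    have "y a \<le> \<mu> a \<and> x a \<le> \<mu> a - y a" for a
    proof -
      have "x a \<le> \<mu> a" "y a \<le> \<mu> a - x a" using that by auto
      then show ?thesis by linarith
    qed
    then show ?thesis by simp
  qed
  show ?thesis
    unfolding sum.Sigma[OF finite_below ballI[OF finite_below]]
  proof (rule sum.reindex_bij_witness[where i="\<lambda>(x, y). (y, x)" and j="\<lambda>(x, y). (y, x)"], goal_cases)
    case (2 x) then show ?case using swap[of "fst x" "snd x"] by (cases x) simp
  next
    case (4 x) then show ?case using swap[of "fst x" "snd x"] by (cases x) simp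
  qed auto
qed

text \<open>Both sides run over the decompositions of \<mu> into three exponents, grouped on the
  left by \<tau> = \<rho> + \<nu>. Since \<open>H\<close> is arbitrary, symbols depending on the
  exponent they act upon are covered.\<close>

lemma sum_below_convolution:
  fixes H :: "'n::finite expo \<Rightarrow> 'n expo \<Rightarrow> 'n expo \<Rightarrow> 'b::comm_monoid_add"
  shows "(\<Sum>\<tau>\<in>below \<mu>. \<Sum>\<rho>\<in>below \<tau>. H \<rho> (\<lambda>a. \<tau> a - \<rho> a) (\<lambda>a. \<mu> a - \<tau> a))
    = (\<Sum>\<nu>\<in>below \<mu>. \<Sum>\<rho>\<in>below (\<lambda>a. \<mu> a - \<nu> a). H \<rho> \<nu> (\<lambda>a. \<mu> a - \<nu> a - \<rho> a))"
proof -
  have down: "(\<lambda>a. \<tau> a - \<rho> a) \<in> below \<mu> \<and> \<rho> \<in> below (\<lambda>a. \<mu> a - (\<tau> a - \<rho> a))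
      \<and> (\<lambda>a. \<tau> a - \<rho> a + \<rho> a) = \<tau> \<and> (\<lambda>a. \<mu> a - (\<tau> a - \<rho> a) - \<rho> a) = (\<lambda>a. \<mu> a - \<tau> a)"
    if "\<tau> \<in> below \<mu>" "\<rho> \<in> below \<tau>" for \<tau> \<rho>
  proof -
    have "\<tau> a - \<rho> a \<le> \<mu> a \<and> \<rho> a \<le> \<mu> a - (\<tau> a - \<rho> a) \<and> \<tau> a - \<rho> a + \<rho> a = \<tau> a
        \<and> \<mu> a - (\<tau> a - \<rho> a) - \<rho> a = \<mu> a - \<tau> a" for a
    proof -
      have "\<tau> a \<le> \<mu> a" "\<rho> a \<le> \<tau> a" using that by auto
      then obtain i j where "\<tau> a = \<rho> a + i" "\<mu> a = \<rho> a + i + j"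
        by (metis le_Suc_ex)
      then show ?thesis by simp
    qed
    then show ?thesis unfolding mem_Collect_eq fun_eq_iff by blast
  qed
  have up: "(\<lambda>a. \<nu> a + \<rho> a) \<in> below \<mu> \<and> \<rho> \<in> below (\<lambda>a. \<nu> a + \<rho> a)
      \<and> (\<lambda>a. \<nu> a + \<rho> a - \<rho> a) = \<nu>"
    if "\<nu> \<in> below \<mu>" "\<rho> \<in> below (\<lambda>a. \<mu> a - \<nu> a)" for \<nu> \<rho>
  proof -
    have "\<nu> a + \<rho> a \<le> \<mu> a" for a
    proof -
      have "\<nu> a \<le> \<mu> a" "\<rho> a \<le> \<mu> a - \<nu> a" using that by auto
      then show ?thesis by linarith
    qed
    then show ?thesis by simp
  qed
  show ?thesis
    unfolding sum.Sigma[OF finite_below ballI[OF finite_below]]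
  proof (rule sum.reindex_bij_witness[where i="\<lambda>(\<nu>, \<rho>). (\<lambda>a. \<nu> a + \<rho> a, \<rho>)"
          and j="\<lambda>(\<tau>, \<rho>). (\<lambda>a. \<tau> a - \<rho> a, \<rho>)"], goal_cases)
    case (1 x) then show ?case using down[of "fst x" "snd x"] by (cases x) (simp only: mem_Sigma_iff prod.case fst_conv snd_conv)
  next
    case (2 x) then show ?case using down[of "fst x" "snd x"] by (cases x) (simp only: mem_Sigma_iff prod.case fst_conv snd_conv)
  next
    case (3 x) then show ?case using up[of "fst x" "snd x"] by (cases x) (simp only: mem_Sigma_iff prod.case fst_conv snd_conv)
  next
    case (4 x) then show ?case using up[of "fst x" "snd x"] by (cases x) (simp only: mem_Sigma_iff prod.case fst_conv snd_conv)
  next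
    case (5 x) then show ?case using down[of "fst x" "snd x"] by (cases x) (simp only: mem_Sigma_iff prod.case fst_conv snd_conv)
  qed
qed

section \<open>Multiplication and rescaling of normally ordered operators\<close>

lemma mmult_prod_series:
  "mmult (prod_series g) (prod_series g') = prod_series (\<lambda>a. g a * g' a)"
proof
  fix \<mu> :: "'a expo"
  have "prod_series (\<lambda>a. g a * g' a) \<mu>
      = (\<Prod>a\<in>UNIV. \<Sum>i\<in>{..\<mu> a}. fps_nth (g a) i * fps_nth (g' a) (\<mu> a - i))"
    by (simp add: prod_series_def fps_mult_nth atLeast0AtMost)
  \<comment> \<open>\<open>below \<mu>\<close> is a product of intervals, so the product of
    one-variable sums expands into a sum over \<nu>.\<close>
  also have "\<dots> = (\<Sum>\<nu>\<in>below \<mu>. \<Prod>a\<in>UNIV. fps_nth (g a) (\<nu> a) * fps_nth (g' a) (\<mu> a - \<nu> a))"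
    unfolding below_eq_PiE by (rule prod_sum_PiE) auto
  finally show "mmult (prod_series g) (prod_series g') \<mu> = prod_series (\<lambda>a. g a * g' a) \<mu>"
    by (simp add: mmult_def prod_series_def prod.distrib)
qed

text \<open>A multiplication operator already stands to the left of all \<theta>, so it just
  multiplies the symbol at each fixed \<nu>.\<close>

lemma mmult_normal_order:
  "mmult P (normal_order F f) = normal_order (\<lambda>\<nu>. mmult P (F \<nu>)) f"
proof
  fix \<mu> :: "'a expo"
  have "mmult P (normal_order F f) \<mu> = (\<Sum>\<tau>\<in>below \<mu>. \<Sum>\<nu>\<in>below (\<lambda>a. \<mu> a - \<tau> a).
      P \<tau> * (f \<nu> * F \<nu> (\<lambda>a. \<mu> a - \<tau> a - \<nu> a)))"
    by (simp add: mmult_def normal_order_def sum_distrib_left)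
  also have "\<dots> = (\<Sum>\<nu>\<in>below \<mu>. \<Sum>\<tau>\<in>below (\<lambda>a. \<mu> a - \<nu> a).
      P \<tau> * (f \<nu> * F \<nu> (\<lambda>a. \<mu> a - \<tau> a - \<nu> a)))"
    by (rule sum_below_commute)
  also have "\<dots> = normal_order (\<lambda>\<nu>. mmult P (F \<nu>)) f \<mu>"
    by (simp add: mmult_def normal_order_def sum_distrib_left mult_ac add.commute)
  finally show "mmult P (normal_order F f) \<mu> = normal_order (\<lambda>\<nu>. mmult P (F \<nu>)) f \<mu>" .
qed

text \<open>Rescaling commutes with every \<theta>, so only the x-dependence of the symbol
  changes.\<close>

lemma rescale_normal_order:
  "rescale c (normal_order F f) = normal_order (\<lambda>\<nu>. rescale c (F \<nu>)) (rescale c f)"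
proof
  fix \<mu> :: "'a expo"
  have "(\<Prod>a\<in>UNIV. c a ^ \<mu> a) = (\<Prod>a\<in>UNIV. c a ^ \<nu> a) * (\<Prod>a\<in>UNIV. c a ^ (\<mu> a - \<nu> a))"
    if "\<nu> \<in> below \<mu>" for \<nu>
    using that by (simp add: prod.distrib[symmetric] power_add[symmetric])
  then show "rescale c (normal_order F f) \<mu> = normal_order (\<lambda>\<nu>. rescale c (F \<nu>)) (rescale c f) \<mu>"
    by (auto simp: rescale_def normal_order_def sum_distrib_left intro!: sum.cong)
qed

lemma rescale_prod_series:
  "rescale c (prod_series g) = prod_series (\<lambda>a. g a oo (fps_const (c a) * fps_X))"
  by (auto simp: rescale_def prod_series_def fps_compose_linear prod.distrib)

section \<open>Triangularity in the total degree\<close>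

definition deg :: "'n::finite expo \<Rightarrow> nat" where
  "deg \<nu> = (\<Sum>a\<in>UNIV. \<nu> a)"

lemma deg_less:
  assumes "\<nu> \<in> below \<mu>" "\<nu> \<noteq> \<mu>"
  shows "deg \<nu> < deg \<mu>"
proof -
  obtain a where "\<nu> a \<noteq> \<mu> a" using assms(2) by auto
  then have "\<nu> a < \<mu> a" using assms(1) by (simp add: le_neq_implies_less)
  then show ?thesis
    unfolding deg_def using assms(1) by (intro sum_strict_mono_ex1) auto
qed

lemma deg_mono: "\<nu> \<in> below \<mu> \<Longrightarrow> deg \<nu> \<le> deg \<mu>"
  unfolding deg_def by (intro sum_mono) auto

text \<open>A symbol with constant term 1 gives the identity plus terms that strictly raise the
  degree; splitting off \<nu> = \<mu> exposes this.\<close>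

lemma normal_order_triangular:
  assumes "\<And>\<nu>. F \<nu> (\<lambda>_. 0) = 1"
  shows "normal_order F f \<mu> = f \<mu> + (\<Sum>\<nu>\<in>below \<mu> - {\<mu>}. f \<nu> * F \<nu> (\<lambda>a. \<mu> a - \<nu> a))"
proof -
  have "normal_order F f \<mu> = (\<Sum>\<nu>\<in>below \<mu>. f \<nu> * F \<nu> (\<lambda>a. \<mu> a - \<nu> a))"
    by (simp add: normal_order_def)
  also have "\<dots> = f \<mu> * F \<mu> (\<lambda>a. \<mu> a - \<mu> a) + (\<Sum>\<nu>\<in>below \<mu> - {\<mu>}. f \<nu> * F \<nu> (\<lambda>a. \<mu> a - \<nu> a))"
    by (rule sum.remove) auto
  finally show ?thesis by (simp add: assms)
qed

text \<open>Injectivity, by induction on the degree: once all smaller exponents contribute 0, only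
  the diagonal term remains.\<close>

lemma normal_order_eq_0D:
  assumes "\<And>\<nu>. F \<nu> (\<lambda>_. 0) = 1" and "\<And>\<mu>. normal_order F f \<mu> = 0"
  shows "f \<mu> = 0"
proof (induction \<mu> rule: measure_induct_rule[of deg])
  case (less \<mu>)
  have "f \<nu> * F \<nu> (\<lambda>a. \<mu> a - \<nu> a) = 0" if "\<nu> \<in> below \<mu> - {\<mu>}" for \<nu>
    using less[OF deg_less[of \<nu> \<mu>]] that by simp
  then have "(\<Sum>\<nu>\<in>below \<mu> - {\<mu>}. f \<nu> * F \<nu> (\<lambda>a. \<mu> a - \<nu> a)) = 0"
    by (intro sum.neutral) blast
  then show ?case
    using normal_order_triangular[of F f \<mu>, OF assms(1)] assms(2)[of \<mu>] by simp
qed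

text \<open>Forward substitution for the triangular system \<open>normal_order F f = g\<close>; the
  degree drops in each recursive call.\<close>

function normal_order_solve :: "('n::finite expo \<Rightarrow> 'n mseries) \<Rightarrow> 'n mseries \<Rightarrow> 'n mseries" where
  "normal_order_solve F g \<mu> =
     g \<mu> - (\<Sum>\<nu>\<in>below \<mu> - {\<mu>}. normal_order_solve F g \<nu> * F \<nu> (\<lambda>a. \<mu> a - \<nu> a))"
  by pat_completeness auto
termination
  by (relation "Wellfounded.measure (\<lambda>(F, g, \<mu>). deg \<mu>)") (auto intro!: deg_less)

declare normal_order_solve.simps [simp del]

text \<open>Surjectivity makes \<open>A_L\<close>, which is defined through \<open>inv_into\<close>,
  a right inverse of \<open>A_L_inv\<close>.\<close>

lemma surj_normal_order:
  assumes "\<And>\<nu>. F \<nu> (\<lambda>_. 0) = 1"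
  shows "surj (normal_order F)"
proof (rule surjI)
  show "normal_order F (normal_order_solve F g) = g" for g
  proof
    show "normal_order F (normal_order_solve F g) \<mu> = g \<mu>" for \<mu>
      by (simp add: normal_order_triangular[of F, OF assms] normal_order_solve.simps[of F g \<mu>])
  qed
qed

section \<open>The series \<open>U\<^sub>a / (1 - \<Lambda>)\<close>\<close>

lemma of_int_mod_ring_add:
  "of_int_mod_ring (x + y) = (of_int_mod_ring x + of_int_mod_ring y :: 'n::finite mod_ring)"
  by transfer (simp add: mod_simps)

lemma of_int_mod_ring_CARD: "of_int_mod_ring (int CARD('n)) = (0 :: 'n::finite mod_ring)"
  by transfer simp

text \<open>The exponent of x_a x_(a+1) ... x_(a+r-1); for r > N the run wraps around and the
  cardinality counts multiplicities.\<close>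

definition cyclic_run :: "'n::finite mod_ring \<Rightarrow> nat \<Rightarrow> 'n expo" where
  "cyclic_run a r = (\<lambda>b. card {s. s < r \<and> a + of_int_mod_ring (int s) = b})"

lemma cyclic_run_0 [simp]: "cyclic_run a 0 = (\<lambda>_. 0)"
  by (simp add: cyclic_run_def)

lemma cyclic_run_Suc: "cyclic_run a (Suc r) b = cyclic_run a r b + (if a + of_int_mod_ring (int r) = b then 1 else 0)"
proof -
  have "{s. s < Suc r \<and> a + of_int_mod_ring (int s) = b}
      = {s. s < r \<and> a + of_int_mod_ring (int s) = b} \<union> (if a + of_int_mod_ring (int r) = b then {r} else {})"
    by (auto simp: less_Suc_eq)
  then show ?thesis
    unfolding cyclic_run_def by simp
qed

lemma cyclic_run_1: "cyclic_run a (Suc 0) = (\<lambda>b. if b = a then 1 else 0)"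
  by (auto simp: cyclic_run_Suc of_int_mod_ring_hom.hom_zero)

lemma deg_cyclic_run [simp]: "deg (cyclic_run a r) = r"
proof (induction r)
  case (Suc r)
  have "deg (cyclic_run a (Suc r)) = deg (cyclic_run a r) + (\<Sum>b\<in>UNIV. if a + of_int_mod_ring (int r) = b then 1 else 0)"
    by (simp add: deg_def cyclic_run_Suc[abs_def] sum.distrib)
  then show ?case
    using Suc by simp
qed (simp add: deg_def)

text \<open>Neighbouring exponents cancel along the run, leaving +1 at its start and -1 at the index
  just past its end.\<close>

lemma ev'_cyclic_run:
  "ev' (cyclic_run a r) b = of_bool (b = a) - of_bool (b = a + of_int_mod_ring (int r))"
proof (induction r)
  case 0
  then show ?case by (simp add: ev'_def of_int_mod_ring_hom.hom_zero)
next
  case (Suc r)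
  have "int (Suc r) = int r + 1" by simp
  then have "a + of_int_mod_ring (int r) = prv b \<longleftrightarrow> b = a + of_int_mod_ring (int (Suc r))"
    unfolding prv_def by (simp only: of_int_mod_ring_add) (auto simp: algebra_simps)
  then have "ev' (cyclic_run a (Suc r)) b = ev' (cyclic_run a r) b
      + of_bool (b = a + of_int_mod_ring (int r)) - of_bool (b = a + of_int_mod_ring (int (Suc r)))"
    unfolding ev'_def cyclic_run_Suc by (auto simp del: of_nat_Suc)
  then show ?case
    using Suc by simp
qed

text \<open>N consecutive indices meet each class exactly once, so a run of length N is
  \<Lambda>.\<close>

lemma cyclic_run_CARD: "cyclic_run a CARD('n) b = 1" for a b :: "'n::finite mod_ring"
proof -
  let ?s = "nat (to_int_mod_ring (b - a))"
  have "0 \<le> to_int_mod_ring (b - a)" "to_int_mod_ring (b - a) < int CARD('n)"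
    using rangeI[of to_int_mod_ring "b - a"] unfolding range_to_int_mod_ring by auto
  then have "?s < CARD('n)" "a + of_int_mod_ring (int ?s) = b"
    by (simp_all add: nat_less_iff)
  moreover have "s = ?s" if "s < CARD('n)" "a + of_int_mod_ring (int s) = b" for s
  proof -
    have "b - a = of_int_mod_ring (int s)" using that(2) by auto
    then show ?thesis using that(1) by simp
  qed
  ultimately have "{s. s < CARD('n) \<and> a + of_int_mod_ring (int s) = b} = {?s}"
    by blast
  then show ?thesis by (simp add: cyclic_run_def)
qed

lemma cyclic_run_add_CARD: "cyclic_run a (r + CARD('n)) b = cyclic_run a r b + 1" for a b :: "'n::finite mod_ring"
proof (induction r)
  case 0
  then show ?case by (simp add: cyclic_run_CARD)
next
  case (Suc r)
  have "of_int_mod_ring (int (r + CARD('n))) = (of_int_mod_ring (int r) :: 'n mod_ring)"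
    by (simp add: of_int_mod_ring_add of_int_mod_ring_CARD)
  then show ?case
    using Suc by (simp add: cyclic_run_Suc)
qed

lemma cyclic_run_add_mult_CARD: "cyclic_run a (r + n * CARD('n)) b = cyclic_run a r b + n" for a b :: "'n::finite mod_ring"
proof (induction n)
  case (Suc n)
  have "r + Suc n * CARD('n) = (r + n * CARD('n)) + CARD('n)" by simp
  then show ?case
    using Suc cyclic_run_add_CARD[of a "r + n * CARD('n)" b] by (simp add: add_ac)
qed simp

text \<open>\<open>U\<^sub>a / (1 - \<Lambda>)\<close> is the sum of the monomials \<open>x\<^sub>a x\<^bsub>a+1\<^esub> \<cdots> x\<^bsub>a+L-1\<^esub>\<close>, \<open>L \<ge> 1\<close>.\<close>
lemma U_div_1_Lambda:
  "mmult (U a) inverse_1_Lambda \<mu> = (if \<exists>L\<ge>1. \<mu> = cyclic_run a L then 1 else 0)"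
  for a :: "'n::finite mod_ring"
proof -
  let ?N = "CARD('n)"
  have "mmult (U a) inverse_1_Lambda \<mu>
      = (\<Sum>\<nu>\<in>below \<mu>. \<Sum>r=1..?N. (if \<nu> = cyclic_run a r then 1 else 0) * inverse_1_Lambda (\<lambda>b. \<mu> b - \<nu> b))"
    by (simp add: mmult_def U_def cyclic_run_def[symmetric] sum_distrib_right)
  also have "\<dots> = (\<Sum>r=1..?N. \<Sum>\<nu>\<in>below \<mu>. (if \<nu> = cyclic_run a r then 1 else 0) * inverse_1_Lambda (\<lambda>b. \<mu> b - \<nu> b))"
    by (rule sum.swap)
  also have "\<dots> = (\<Sum>r=1..?N. if cyclic_run a r \<in> below \<mu> then inverse_1_Lambda (\<lambda>b. \<mu> b - cyclic_run a r b) else 0)"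
    by (intro sum.cong) (simp_all add: if_distrib[of "\<lambda>x. x * _"] sum.delta cong: if_cong)
  also have "\<dots> = (\<Sum>r=1..?N. if \<exists>n. \<mu> = cyclic_run a (r + n * ?N) then 1 else 0)"
  proof (rule sum.cong)
    fix r
    have "cyclic_run a r \<in> below \<mu> \<and> (\<exists>n. (\<lambda>b. \<mu> b - cyclic_run a r b) = (\<lambda>_. n)) \<longleftrightarrow> (\<exists>n. \<mu> = cyclic_run a (r + n * ?N))"
      (is "?L \<longleftrightarrow> ?R")
    proof
      assume ?L
      then obtain n where n: "\<And>b. cyclic_run a r b \<le> \<mu> b" "\<And>b. \<mu> b - cyclic_run a r b = n"
        by (auto simp: fun_eq_iff)
      have "\<mu> b = cyclic_run a r b + n" for b
        using n(1)[of b] n(2)[of b] by simp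
      then have "\<mu> = cyclic_run a (r + n * ?N)"
        by (simp add: fun_eq_iff cyclic_run_add_mult_CARD)
      then show ?R ..
    next
      assume ?R
      then show ?L by (auto simp: cyclic_run_add_mult_CARD)
    qed
    then show "(if cyclic_run a r \<in> below \<mu> then inverse_1_Lambda (\<lambda>b. \<mu> b - cyclic_run a r b) else 0)
        = (if \<exists>n. \<mu> = cyclic_run a (r + n * ?N) then 1 else (0 :: complex))"
      by (auto simp: inverse_1_Lambda_def)
  qed simp
  also have "\<dots> = (if \<exists>L\<ge>1. \<mu> = cyclic_run a L then 1 else 0)"
  proof (cases "\<exists>L\<ge>1. \<mu> = cyclic_run a L")
    case False
    then have "\<not> (\<exists>n. \<mu> = cyclic_run a (r + n * ?N))" if "r \<in> {1..?N}" for r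
      using that by (metis atLeastAtMost_iff trans_le_add1)
    then show ?thesis using False by simp
  next
    case True
    then obtain L where L: "L \<ge> 1" "\<mu> = cyclic_run a L" by auto
    \<comment> \<open>Division with remainder shifted by one, since r ranges over 1..N and not
      0..N-1. The degree recovers L, so an equality of runs is an equality of lengths.\<close>
    have eq: "(\<exists>n. \<mu> = cyclic_run a (r + n * ?N)) \<longleftrightarrow> r = (L - 1) mod ?N + 1" if "r \<in> {1..?N}" for r
    proof -
      have "(\<exists>n. \<mu> = cyclic_run a (r + n * ?N)) \<longleftrightarrow> (\<exists>n. L = r + n * ?N)"
        using L(2) deg_cyclic_run by metis
      also have "\<dots> \<longleftrightarrow> r = (L - 1) mod ?N + 1"
      proof
        assume "\<exists>n. L = r + n * ?N"
        then obtain n where "L = r + n * ?N" by auto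
        then have "L - 1 = (r - 1) + n * ?N" using that by auto
        then have "(L - 1) mod ?N = (r - 1) mod ?N" by (simp only: mod_mult_self1)
        moreover have "(r - 1) mod ?N = r - 1" using that by (intro mod_less) auto
        ultimately have "(L - 1) mod ?N = r - 1" by (rule trans)
        then show "r = (L - 1) mod ?N + 1" using that by simp
      next
        assume "r = (L - 1) mod ?N + 1"
        moreover have "L - 1 = (L - 1) mod ?N + (L - 1) div ?N * ?N" by simp
        ultimately have "L = r + (L - 1) div ?N * ?N" using L(1) by linarith
        then show "\<exists>n. L = r + n * ?N" by blast
      qed
      finally show ?thesis .
    qed
    have "(L - 1) mod ?N + 1 \<in> {1..?N}" by (simp add: Suc_leI)
    then have "(\<Sum>r=1..?N. if r = (L - 1) mod ?N + 1 then 1 else (0::complex)) = 1"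
      by simp
    then show ?thesis
      using True by (simp only: if_True eq cong: sum.cong)
  qed
  finally show ?thesis .
qed

text \<open>The degree recovers the length, so runs of different lengths are distinct and a run
  below \<sigma> has length at most \<open>deg \<sigma>\<close>.\<close>

lemma sum_U_div_1_Lambda:
  "(\<Sum>\<rho>\<in>below \<sigma>. mmult (U a) inverse_1_Lambda \<rho> * X \<rho>)
    = (\<Sum>L=1..deg \<sigma>. if cyclic_run a L \<in> below \<sigma> then X (cyclic_run a L) else 0)"
proof -
  let ?I = "{L \<in> {1..deg \<sigma>}. cyclic_run a L \<in> below \<sigma>}"
  have "(\<Sum>\<rho>\<in>below \<sigma>. mmult (U a) inverse_1_Lambda \<rho> * X \<rho>) = (\<Sum>\<rho>\<in>cyclic_run a ` ?I. X \<rho>)"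
  proof (rule sum.mono_neutral_cong_right)
    show "\<forall>\<rho>\<in>below \<sigma> - cyclic_run a ` ?I. mmult (U a) inverse_1_Lambda \<rho> * X \<rho> = 0"
    proof
      fix \<rho> assume \<rho>: "\<rho> \<in> below \<sigma> - cyclic_run a ` ?I"
      have "\<not> (\<exists>L\<ge>1. \<rho> = cyclic_run a L)"
      proof
        assume "\<exists>L\<ge>1. \<rho> = cyclic_run a L"
        then obtain L where "L \<ge> 1" "\<rho> = cyclic_run a L" by auto
        with \<rho> deg_mono[of \<rho> \<sigma>] show False by auto
      qed
      then show "mmult (U a) inverse_1_Lambda \<rho> * X \<rho> = 0"
        by (simp only: U_div_1_Lambda if_False mult_zero_left)
    qed
    show "mmult (U a) inverse_1_Lambda \<rho> * X \<rho> = X \<rho>" if "\<rho> \<in> cyclic_run a ` ?I" for \<rho>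
    proof -
      have "\<exists>L\<ge>1. \<rho> = cyclic_run a L" using that by auto
      then show ?thesis by (simp only: U_div_1_Lambda if_True mult_1_left)
    qed
  qed auto
  also have "\<dots> = (\<Sum>L\<in>?I. X (cyclic_run a L))"
    by (rule sum.reindex_cong[where l="cyclic_run a"]) (auto intro: inj_on_inverseI[where g=deg])
  also have "\<dots> = (\<Sum>L=1..deg \<sigma>. if cyclic_run a L \<in> below \<sigma> then X (cyclic_run a L) else 0)"
    by (rule sum.inter_filter) simp
  finally show ?thesis .
qed

text \<open>The coefficients of \<open>(1 - x)\<^bsup>-s\<^esup>\<close>.\<close>
definition nbin :: "complex \<Rightarrow> nat \<Rightarrow> complex" where
  "nbin s n = pochhammer s n / fact n"

lemma nbin_0 [simp]: "nbin s 0 = 1"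
  by (simp add: nbin_def)

text \<open>Coefficient of x^n in s (1-x)^(-s-1), the derivative of (1-x)^(-s).\<close>

lemma nbin_Suc_left: "s * nbin (s + 1) n = of_nat (Suc n) * nbin s (Suc n)"
  using of_nat_neq_0[of n, where 'a=complex] by (simp add: nbin_def pochhammer_rec field_simps del: of_nat_Suc)

text \<open>Coefficient of x^(n+1) in (1-x) (1-x)^(-s).\<close>

lemma nbin_pascal: "nbin (s - 1) (Suc n) = nbin s (Suc n) - nbin s n"
proof -
  define p where "p = pochhammer s n / fact (Suc n)"
  have "nbin (s - 1) (Suc n) = (s - 1) * p"
    by (simp add: nbin_def pochhammer_rec p_def)
  moreover have "nbin s (Suc n) = (s + of_nat n) * p"
    by (simp add: nbin_def pochhammer_Suc p_def)
  moreover have "nbin s n = of_nat (Suc n) * p"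
    using of_nat_neq_0[of n, where 'a=complex] by (simp add: nbin_def p_def del: of_nat_Suc)
  ultimately show ?thesis
    by (simp add: algebra_simps)
qed

text \<open>Multiplying \<open>x\<^sub>a \<cdots> x\<^bsub>a+L-1\<^esub>\<close> by \<open>(1 - x\<^bsub>a+L\<^esub>) / (1 - x\<^sub>a)\<close> makes the sum over \<open>L\<close> telescope.\<close>
lemma sum_cyclic_run_telescope:
  fixes s :: "'n::finite mod_ring \<Rightarrow> complex" and \<sigma> :: "'n expo"
  shows "s a * (\<Sum>\<rho>\<in>below \<sigma>. mmult (U a) inverse_1_Lambda \<rho> *
        (\<Prod>b\<in>UNIV. nbin (s b + ev' \<rho> b) (\<sigma> b - \<rho> b)))
    = of_nat (\<sigma> a) * (\<Prod>b\<in>UNIV. nbin (s b) (\<sigma> b))"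
proof -
  \<comment> \<open>\<open>s'\<close> takes in the +1 that \<theta>' contributes at the start of a
    run. \<open>H L\<close> is the coefficient at \<sigma> of the run of length L times the product
    of all (1 - x_b)^(-s'_b), and 0 if the run does not fit.\<close>
  define s' where "s' b = s b + of_bool (b = a)" for b
  define H where "H L = (if cyclic_run a L \<in> below \<sigma> then \<Prod>b\<in>UNIV. nbin (s' b) (\<sigma> b - cyclic_run a L b) else 0)" for L
  have step: "(if cyclic_run a L \<in> below \<sigma> then \<Prod>b\<in>UNIV. nbin (s b + ev' (cyclic_run a L) b) (\<sigma> b - cyclic_run a L b) else 0)
      = H L - H (Suc L)" for L
  proof (cases "cyclic_run a L \<in> below \<sigma>")
    case False
    moreover have "cyclic_run a L b \<le> cyclic_run a (Suc L) b" for b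
      by (simp add: cyclic_run_Suc)
    ultimately have "cyclic_run a (Suc L) \<notin> below \<sigma>"
      unfolding mem_Collect_eq by (meson le_trans)
    then show ?thesis using False by (simp only: H_def if_False diff_0_right)
  next
    case True
    \<comment> \<open>At the index \<open>c\<close> just past the run \<theta>' contributes -1, and
      only there does lengthening the run change the exponent. The Pascal rule at \<open>c\<close>
      therefore yields the two terms.\<close>
    define c where "c = a + of_int_mod_ring (int L)"
    define R where "R = (\<Prod>b\<in>UNIV - {c}. nbin (s' b) (\<sigma> b - cyclic_run a L b))"
    have "(\<Prod>b\<in>UNIV. nbin (s b + ev' (cyclic_run a L) b) (\<sigma> b - cyclic_run a L b))
        = (\<Prod>b\<in>UNIV. nbin (s' b - of_bool (b = c)) (\<sigma> b - cyclic_run a L b))"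
      by (simp add: ev'_cyclic_run s'_def c_def add_diff_eq)
    also have "\<dots> = nbin (s' c - 1) (\<sigma> c - cyclic_run a L c) * R"
      unfolding R_def by (subst prod.remove[of UNIV c]) auto
    finally have T: "(\<Prod>b\<in>UNIV. nbin (s b + ev' (cyclic_run a L) b) (\<sigma> b - cyclic_run a L b))
        = nbin (s' c - 1) (\<sigma> c - cyclic_run a L c) * R" .
    have HL: "H L = nbin (s' c) (\<sigma> c - cyclic_run a L c) * R"
      using True unfolding H_def R_def by (simp only: if_True) (rule prod.remove; simp)
    have pS: "cyclic_run a (Suc L) b = cyclic_run a L b + of_bool (b = c)" for b
      by (simp add: cyclic_run_Suc c_def)
    show ?thesis
    proof (cases "\<sigma> c - cyclic_run a L c")
      \<comment> \<open>No room is left at \<open>c\<close>: the longer run does not fit, and the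
        binomial factors at \<open>c\<close> in the summand and in \<open>H L\<close> are both
        1.\<close>
      case 0
      then have "cyclic_run a (Suc L) c > \<sigma> c" by (simp add: pS)
      then have "cyclic_run a (Suc L) \<notin> below \<sigma>"
        unfolding mem_Collect_eq by (meson not_le)
      then have "H (Suc L) = 0" by (simp only: H_def if_False)
      then show ?thesis using True T HL 0 by (simp only: if_True nbin_0 diff_0_right)
    next
      case (Suc n)
      then have "cyclic_run a (Suc L) b \<le> \<sigma> b" for b
        using True by (cases "b = c") (simp_all add: pS)
      then have "cyclic_run a (Suc L) \<in> below \<sigma>" by simp
      then have "H (Suc L) = (\<Prod>b\<in>UNIV. nbin (s' b) (\<sigma> b - cyclic_run a (Suc L) b))"
        by (simp only: H_def if_True)
      also have "\<dots> = nbin (s' c) (\<sigma> c - cyclic_run a (Suc L) c) * R"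
        unfolding R_def by (subst prod.remove[of UNIV c]) (auto simp: pS)
      also have "\<sigma> c - cyclic_run a (Suc L) c = n"
        using Suc by (simp add: pS)
      finally have HS: "H (Suc L) = nbin (s' c) n * R" .
      have "nbin (s' c - 1) (\<sigma> c - cyclic_run a L c) = nbin (s' c) (\<sigma> c - cyclic_run a L c) - nbin (s' c) n"
        unfolding Suc by (rule nbin_pascal)
      then show ?thesis
        unfolding if_P[OF True] T HL HS by (simp only: left_diff_distrib)
    qed
  qed
  have "(\<Sum>\<rho>\<in>below \<sigma>. mmult (U a) inverse_1_Lambda \<rho> *
        (\<Prod>b\<in>UNIV. nbin (s b + ev' \<rho> b) (\<sigma> b - \<rho> b)))
      = (\<Sum>L=1..deg \<sigma>. H L - H (Suc L))"
    unfolding sum_U_div_1_Lambda step ..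
  also have "\<dots> = H 1 - H (Suc (deg \<sigma>))"
    using sum_Suc_diff[of 1 "deg \<sigma>" "\<lambda>L. - H L"] by simp
  also have "H (Suc (deg \<sigma>)) = 0"
  proof -
    have "cyclic_run a (Suc (deg \<sigma>)) \<notin> below \<sigma>"
      using deg_mono[of "cyclic_run a (Suc (deg \<sigma>))" \<sigma>] unfolding deg_cyclic_run by linarith
    then show ?thesis by (simp only: H_def if_False)
  qed
  finally have sum: "(\<Sum>\<rho>\<in>below \<sigma>. mmult (U a) inverse_1_Lambda \<rho> *
        (\<Prod>b\<in>UNIV. nbin (s b + ev' \<rho> b) (\<sigma> b - \<rho> b))) = H 1"
    by (simp only: diff_0_right)
  \<comment> \<open>Only the run consisting of x_a survives. If \<sigma> a = 0 both sides vanish;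
    otherwise \<open>nbin_Suc_left\<close> uses the prefactor \<open>s a\<close> to undo the shift
    in \<open>s'\<close>.\<close>
  show ?thesis
  proof (cases "\<sigma> a")
    case 0
    then have "cyclic_run a 1 \<notin> below \<sigma>" by (auto simp: cyclic_run_1)
    then have "H 1 = 0" by (simp only: H_def if_False)
    then show ?thesis unfolding sum 0 by simp
  next
    case (Suc n)
    then have "cyclic_run a 1 \<in> below \<sigma>" by (auto simp: cyclic_run_1)
    then have "H 1 = (\<Prod>b\<in>UNIV. nbin (s' b) (\<sigma> b - (if b = a then 1 else 0)))"
      by (simp only: H_def if_True) (simp add: cyclic_run_1)
    also have "\<dots> = nbin (s a + 1) n * (\<Prod>b\<in>UNIV - {a}. nbin (s b) (\<sigma> b))"
      using Suc by (subst prod.remove[of UNIV a]) (auto simp: s'_def)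
    finally have "s a * H 1 = (s a * nbin (s a + 1) n) * (\<Prod>b\<in>UNIV - {a}. nbin (s b) (\<sigma> b))"
      by simp
    also have "\<dots> = of_nat (\<sigma> a) * (nbin (s a) (\<sigma> a) * (\<Prod>b\<in>UNIV - {a}. nbin (s b) (\<sigma> b)))"
      using Suc by (simp add: nbin_Suc_left)
    also have "nbin (s a) (\<sigma> a) * (\<Prod>b\<in>UNIV - {a}. nbin (s b) (\<sigma> b)) = (\<Prod>b\<in>UNIV. nbin (s b) (\<sigma> b))"
      by (rule prod.remove[symmetric]) auto
    finally show ?thesis unfolding sum .
  qed
qed

section \<open>The limit \<open>h \<rightarrow> 0\<close>\<close>

lemma qp_has_derivative_0: "((\<lambda>h. qp h s) has_field_derivative s) (at 0 within S)"
  unfolding qp_def by (auto intro!: derivative_eq_intros)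

text \<open>This is the derivative at h = 0, where both exponentials are 1; it supplies the
  first-order term of the difference equation.\<close>

lemma tendsto_qp_diff_div:
  "((\<lambda>h. (qp h s - qp h t) / h) \<longlongrightarrow> s - t) (at 0 within S)"
proof -
  have "((\<lambda>h. qp h s - qp h t) has_field_derivative (s - t)) (at 0 within S)"
    by (intro derivative_intros qp_has_derivative_0)
  then show ?thesis
    unfolding has_field_derivative_iff by (simp add: qp_def)
qed

lemma tendsto_one_minus_qp_div: "((\<lambda>h. (1 - qp h s) / h) \<longlongrightarrow> - s) (at 0 within S)"
  using tendsto_qp_diff_div[of 0 s S] by (simp add: qp_def)

lemma tendsto_qp: "((\<lambda>h. qp h s) \<longlongrightarrow> 1) (at 0 within S)"
proof -
  have "((\<lambda>h. qp h s) \<longlongrightarrow> exp (0 * s)) (at 0 within S)"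
    unfolding qp_def by (intro tendsto_intros)
  then show ?thesis by simp
qed

lemma eventually_at_0_within_nonzero: "eventually (\<lambda>h. h \<noteq> 0) (at (0 :: complex) within S)"
  by (simp add: eventually_at_filter)

lemma tendsto_qbin: "((\<lambda>h. qbin h s n) \<longlongrightarrow> nbin s n) (at 0 within S)"
proof -
  have "((\<lambda>h. (1 - qp h (s + of_nat l)) / (1 - qp h (of_nat (Suc l))))
      \<longlongrightarrow> (s + of_nat l) / of_nat (Suc l)) (at 0 within S)" for l
  proof -
    \<comment> \<open>Both parts of the fraction may vanish at h = 0; after division by h the
      denominator tends to -(l+1), which is nonzero.\<close>
    have "((\<lambda>h. ((1 - qp h (s + of_nat l)) / h) / ((1 - qp h (of_nat (Suc l))) / h))
        \<longlongrightarrow> - (s + of_nat l) / - of_nat (Suc l)) (at 0 within S)"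
      by (intro tendsto_divide tendsto_one_minus_qp_div) (simp del: of_nat_Suc)
    then have "((\<lambda>h. ((1 - qp h (s + of_nat l)) / h) / ((1 - qp h (of_nat (Suc l))) / h))
        \<longlongrightarrow> (s + of_nat l) / of_nat (Suc l)) (at 0 within S)"
      by (simp only: minus_divide_divide)
    then show ?thesis
    proof (rule Lim_transform_eventually)
      show "\<forall>\<^sub>F h in at 0 within S. ((1 - qp h (s + of_nat l)) / h) / ((1 - qp h (of_nat (Suc l))) / h)
          = (1 - qp h (s + of_nat l)) / (1 - qp h (of_nat (Suc l)))"
        using eventually_at_0_within_nonzero by eventually_elim simp
    qed
  qed
  then have "((\<lambda>h. qbin h s n) \<longlongrightarrow> (\<Prod>l<n. (s + of_nat l) / of_nat (Suc l))) (at 0 within S)"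
    unfolding qbin_def by (intro tendsto_prod)
  also have "(\<Prod>l<n. (s + of_nat l) / of_nat (Suc l)) = nbin s n"
    by (induction n) (simp_all add: nbin_def pochhammer_Suc)
  finally show ?thesis .
qed

section \<open>Leading order in h of the partition function\<close>

lemma tendsto_qbracket:
  "((\<lambda>h. qbracket h s n / h ^ n) \<longlongrightarrow> (\<Prod>l<n. - (s + of_nat l))) (at 0 within S)"
proof -
  have "((\<lambda>h. qp h (- (s * of_nat n / 2)) * qp h (- (of_nat n * (of_nat n - 1) / 4))
      * (\<Prod>l<n. (1 - qp h (s + of_nat l)) / h)) \<longlongrightarrow> 1 * 1 * (\<Prod>l<n. - (s + of_nat l))) (at 0 within S)"
    by (intro tendsto_mult tendsto_prod tendsto_qp tendsto_one_minus_qp_div)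
  moreover have "(\<Prod>l<n. (1 - qp h (s + of_nat l)) / h) = (\<Prod>l<n. 1 - qp h s * qp h 1 ^ l) / h ^ n" for h
    by (simp add: prod_dividef qp_add qp_power)
  ultimately show ?thesis
    by (simp add: qbracket_def)
qed

text \<open>If some exponent s + l were 0, the factor 1 - q^(s+l) would vanish for every h. So
  nonvanishing at one h forces a nonzero leading coefficient.\<close>

lemma qbracket_nonzero_imp:
  assumes "qbracket h s n \<noteq> 0"
  shows "(\<Prod>l<n. - (s + of_nat l)) \<noteq> 0"
proof -
  have "s + of_nat l \<noteq> 0" if "l < n" for l
  proof
    assume "s + of_nat l = 0"
    then have "qp h s * qp h 1 ^ l = 1"
      by (metis qp_0 qp_add qp_power mult_1_right)
    then have "(\<Prod>l<n. 1 - qp h s * qp h 1 ^ l) = 0"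
      using that by (intro prod_zero) auto
    with assms show False by (simp add: qbracket_def)
  qed
  then have "- (s + of_nat l) \<noteq> 0" if "l < n" for l
    using that by (simp only: neg_equal_0_iff_equal not_False_eq_True)
  then show ?thesis
    unfolding prod_zero_iff[OF finite_lessThan] by blast
qed

abbreviation Nek_left :: "'n::finite mod_ring \<Rightarrow> (nat \<Rightarrow> nat) \<Rightarrow> (nat \<times> nat) set" where
  "Nek_left r lam \<equiv> {(i, j). 1 \<le> i \<and> i \<le> j \<and> lam j \<noteq> 0 \<and> of_int_mod_ring (int j - int i) = r}"

abbreviation Nek_right :: "'n::finite mod_ring \<Rightarrow> (nat \<Rightarrow> nat) \<Rightarrow> (nat \<times> nat) set" where
  "Nek_right r mu \<equiv> {(a, b). 1 \<le> a \<and> a \<le> b \<and> mu b \<noteq> 0 \<and>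
     of_int_mod_ring (int b - int a) = - r - of_int_mod_ring 1}"

text \<open>The total length of the brackets in \<open>Nek\<close>, hence the power of h to be
  divided out.\<close>

definition Nek_order :: "'n::finite mod_ring \<Rightarrow> (nat \<Rightarrow> nat) \<Rightarrow> (nat \<Rightarrow> nat) \<Rightarrow> nat" where
  "Nek_order r lam mu = (\<Sum>(i, j)\<in>Nek_left r lam. lam j - lam (Suc j))
     + (\<Sum>(a, b)\<in>Nek_right r mu. mu b - mu (Suc b))"

text \<open>Each of the two sums sees only one partition, so the orders of numerator and denominator
  agree.\<close>

lemma Nek_order_split: "Nek_order r lam mu = Nek_order r (\<lambda>_. 0) mu + Nek_order r lam (\<lambda>_. 0)"
  by (simp add: Nek_order_def)

lemma tendsto_Nek:
  fixes r :: "'n::finite mod_ring"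
  shows "\<exists>L. ((\<lambda>h. Nek h k r lam mu s / h ^ Nek_order r lam mu) \<longlongrightarrow> L) (at 0 within S)
    \<and> ((\<exists>h. Nek h k r lam mu s \<noteq> 0) \<longrightarrow> L \<noteq> 0)"
proof -
  define sl where "sl = (\<lambda>(i, j). s - of_nat (mu i) + of_nat (lam (Suc j)) + k * (of_nat j - of_nat i))"
  define nl where "nl = (\<lambda>(i :: nat, j). lam j - lam (Suc j))"
  define sr where "sr = (\<lambda>(a, b). s + of_nat (lam a) - of_nat (mu b) + k * (of_nat a - of_nat b - 1))"
  define nr where "nr = (\<lambda>(a :: nat, b). mu b - mu (Suc b))"
  define c :: "complex \<Rightarrow> nat \<Rightarrow> complex" where "c t n = (\<Prod>l<n. - (t + of_nat l))" for t n
  let ?A = "Nek_left r lam" and ?B = "Nek_right r mu"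
  have Nek: "Nek h k r lam mu s = (\<Prod>x\<in>?A. qbracket h (sl x) (nl x)) * (\<Prod>x\<in>?B. qbracket h (sr x) (nr x))" for h
    unfolding Nek_def sl_def nl_def sr_def nr_def
    by (intro arg_cong2[where f="(*)"] prod.cong) auto
  have order: "Nek_order r lam mu = (\<Sum>x\<in>?A. nl x) + (\<Sum>x\<in>?B. nr x)"
    unfolding Nek_order_def nl_def nr_def ..
  show ?thesis
  proof (intro exI conjI impI)
    have "((\<lambda>h. (\<Prod>x\<in>?A. qbracket h (sl x) (nl x) / h ^ nl x) * (\<Prod>x\<in>?B. qbracket h (sr x) (nr x) / h ^ nr x))
      \<longlongrightarrow> (\<Prod>x\<in>?A. c (sl x) (nl x)) * (\<Prod>x\<in>?B. c (sr x) (nr x))) (at 0 within S)"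
      unfolding c_def by (intro tendsto_mult tendsto_prod tendsto_qbracket)
    then show "((\<lambda>h. Nek h k r lam mu s / h ^ Nek_order r lam mu)
      \<longlongrightarrow> (\<Prod>x\<in>?A. c (sl x) (nl x)) * (\<Prod>x\<in>?B. c (sr x) (nr x))) (at 0 within S)"
      unfolding Nek order power_add power_sum prod_dividef by simp
  next
    assume "\<exists>h. Nek h k r lam mu s \<noteq> 0"
    then obtain h where nz: "Nek h k r lam mu s \<noteq> 0" ..
    have "(\<Prod>x\<in>X. c (t x) (n x)) \<noteq> 0" if "(\<Prod>x\<in>X. qbracket h (t x) (n x)) \<noteq> 0"
      for X :: "(nat \<times> nat) set" and t n
    \<comment> \<open>For infinite \<open>X\<close> the product is 1 by convention.\<close>
    proof (cases "finite X")
      case True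
      then have "qbracket h (t x) (n x) \<noteq> 0" if "x \<in> X" for x
        using that \<open>(\<Prod>x\<in>X. qbracket h (t x) (n x)) \<noteq> 0\<close> by (auto simp: prod_zero_iff)
      then have "c (t x) (n x) \<noteq> 0" if "x \<in> X" for x
        using qbracket_nonzero_imp that unfolding c_def by blast
      then show ?thesis
        unfolding prod_zero_iff[OF True] by blast
    qed simp
    then show "(\<Prod>x\<in>?A. c (sl x) (nl x)) * (\<Prod>x\<in>?B. c (sr x) (nr x)) \<noteq> 0"
      using nz unfolding Nek mult_eq_0_iff de_Morgan_disj by blast
  qed
qed

text \<open>The numerator and the denominator of a summand of the partition function have the same number
  of factors \<open>1 - q\<^sup>s\<close>, so the powers of \<open>h\<close> cancel.\<close>
lemma laumon_Z_convergent:
  fixes \<alpha> \<beta> \<sigma> :: "'n::finite mod_ring \<Rightarrow> complex"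
  assumes "admissible k \<beta> \<noteq> {}"
  shows "\<exists>L. ((\<lambda>h. laumon_Z h k \<alpha> \<beta> \<sigma> \<nu>) \<longlongrightarrow> L) (at 0 within S)"
proof -
  have factor: "\<exists>L. ((\<lambda>h. Nek h k (j - i) (\<lambda>_. 0) (lam j) (\<alpha> i - \<beta> j) * Nek h k (j - i) (lam i) (\<lambda>_. 0) (\<beta> i - \<sigma> j)
         / Nek h k (j - i) (lam i) (lam j) (\<beta> i - \<beta> j)) \<longlongrightarrow> L) (at 0 within S)"
    if lam: "\<forall>i. is_partition (lam i)" for lam i j
  proof -
    let ?N1 = "\<lambda>h. Nek h k (j - i) (\<lambda>_. 0) (lam j) (\<alpha> i - \<beta> j)"
    let ?N2 = "\<lambda>h. Nek h k (j - i) (lam i) (\<lambda>_. 0) (\<beta> i - \<sigma> j)"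
    let ?N3 = "\<lambda>h. Nek h k (j - i) (lam i) (lam j) (\<beta> i - \<beta> j)"
    let ?o1 = "Nek_order (j - i) (\<lambda>_. 0) (lam j)"
    let ?o2 = "Nek_order (j - i) (lam i) (\<lambda>_. 0)"
    obtain L1 where L1: "((\<lambda>h. ?N1 h / h ^ ?o1) \<longlongrightarrow> L1) (at 0 within S)"
      using tendsto_Nek[of k "j - i" "\<lambda>_. 0" "lam j" "\<alpha> i - \<beta> j" S] by blast
    obtain L2 where L2: "((\<lambda>h. ?N2 h / h ^ ?o2) \<longlongrightarrow> L2) (at 0 within S)"
      using tendsto_Nek[of k "j - i" "lam i" "\<lambda>_. 0" "\<beta> i - \<sigma> j" S] by blast
    obtain L3 where L3: "((\<lambda>h. ?N3 h / h ^ Nek_order (j - i) (lam i) (lam j)) \<longlongrightarrow> L3) (at 0 within S)"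
      and nz: "(\<exists>h. ?N3 h \<noteq> 0) \<longrightarrow> L3 \<noteq> 0"
      using tendsto_Nek[of k "j - i" "lam i" "lam j" "\<beta> i - \<beta> j" S] by blast
    \<comment> \<open>Any one admissible h shows that the denominator is nonzero there, and so that
      its leading coefficient is nonzero.\<close>
    have "L3 \<noteq> 0"
      using assms lam nz unfolding admissible_def by blast
    then have "((\<lambda>h. (?N1 h / h ^ ?o1) * (?N2 h / h ^ ?o2) / (?N3 h / h ^ Nek_order (j - i) (lam i) (lam j)))
        \<longlongrightarrow> L1 * L2 / L3) (at 0 within S)"
      by (intro tendsto_divide tendsto_mult L1 L2 L3)
    then have "((\<lambda>h. ?N1 h * ?N2 h / ?N3 h) \<longlongrightarrow> L1 * L2 / L3) (at 0 within S)"
    proof (rule Lim_transform_eventually)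
      show "\<forall>\<^sub>F h in at 0 within S. (?N1 h / h ^ ?o1) * (?N2 h / h ^ ?o2)
          / (?N3 h / h ^ Nek_order (j - i) (lam i) (lam j)) = ?N1 h * ?N2 h / ?N3 h"
        using eventually_at_0_within_nonzero
        by eventually_elim (simp add: Nek_order_split[of _ "lam i" "lam j"] power_add)
    qed
    then show ?thesis by blast
  qed
  let ?Lam = "{lam. (\<forall>i. is_partition (lam i)) \<and> box_count lam = \<nu>}"
  let ?t = "\<lambda>h lam i j. Nek h k (j - i) (\<lambda>_. 0) (lam j) (\<alpha> i - \<beta> j) * Nek h k (j - i) (lam i) (\<lambda>_. 0) (\<beta> i - \<sigma> j)
         / Nek h k (j - i) (lam i) (lam j) (\<beta> i - \<beta> j)"
  \<comment> \<open>Choice fixes the limits as a function of the tuple and the indices, so that they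
    can be combined in products and sums.\<close>
  define L where "L lam i j = (SOME l. ((\<lambda>h. ?t h lam i j) \<longlongrightarrow> l) (at 0 within S))" for lam i j
  have L: "((\<lambda>h. ?t h lam i j) \<longlongrightarrow> L lam i j) (at 0 within S)" if "lam \<in> ?Lam" for lam i j
  proof -
    have "\<forall>i. is_partition (lam i)" using that by blast
    from someI_ex[OF factor[OF this]] show ?thesis
      unfolding L_def .
  qed
  have "((\<lambda>h. \<Sum>lam\<in>?Lam. \<Prod>i\<in>UNIV. \<Prod>j\<in>UNIV. ?t h lam i j)
      \<longlongrightarrow> (\<Sum>lam\<in>?Lam. \<Prod>i\<in>UNIV. \<Prod>j\<in>UNIV. L lam i j)) (at 0 within S)"
    by (intro tendsto_sum tendsto_prod L)
  then show ?thesis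
    unfolding laumon_Z_def by blast
qed

text \<open>The rescalings and q^(\<Delta>/2) tend to 1, so the limit comes from the partition
  function alone. The limit point makes the filter nontrivial, so that \<open>Lim\<close> returns
  this limit.\<close>

lemma psi5d_convergent:
  fixes \<beta> :: "'n::finite mod_ring \<Rightarrow> complex"
  assumes "0 islimpt admissible k \<beta>"
  shows "((\<lambda>h. psi5d h k \<beta> m mt \<nu>) \<longlongrightarrow> psi4d k \<beta> m mt \<nu>) (at 0 within admissible k \<beta>)"
proof -
  let ?F = "at 0 within admissible k \<beta>"
  have "admissible k \<beta> \<noteq> {}" using assms by (auto simp: islimpt_def)
  then obtain Z where Z: "((\<lambda>h. laumon_Z h k (\<lambda>i. 1 + k + \<beta> (prv i) - m (prv i)) \<beta> (\<lambda>i. \<beta> i - mt i) \<nu>)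
      \<longlongrightarrow> Z) ?F"
    using laumon_Z_convergent by blast
  have "((\<lambda>h. psi5d h k \<beta> m mt \<nu>) \<longlongrightarrow> (\<Prod>a\<in>UNIV. (1 / 1) ^ \<nu> a) * (1 * ((\<Prod>a\<in>UNIV. 1 ^ \<nu> a) * Z))) ?F"
    unfolding psi5d_def psi_def rescale_def q_half_Delta_def
    by (intro tendsto_mult tendsto_prod tendsto_power tendsto_divide tendsto_const tendsto_qp Z) simp
  moreover have "?F \<noteq> bot"
    using assms by (simp add: trivial_limit_within)
  ultimately show ?thesis
    unfolding psi4d_def using tendsto_Lim by metis
qed

section \<open>The difference equation to first order in h\<close>

lemma qp_sum: "qp h (\<Sum>a\<in>A. f a) = (\<Prod>a\<in>A. qp h (f a))"
  by (induction A rule: infinite_finite_induct) (simp_all add: qp_add)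

lemma A1_nth:
  fixes f :: "'n::finite mseries"
  assumes "Re h < 0"
  shows "A1 h \<gamma> mt f \<mu> = (\<Sum>\<nu>\<in>below \<mu>. f \<nu> *
    ((\<Prod>a\<in>UNIV. qbin h (ev' \<nu> a + mt a) (\<mu> a - \<nu> a)) * qp h (\<Sum>a\<in>UNIV. \<gamma> a * of_nat (\<nu> a))))"
  using assms
  by (simp add: A1_def normal_order_def prod_series_def phi_fps_ratio_nth prod.distrib qp_sum)

text \<open>Scaling x_a by q^(-\<theta>'_a - m_a) reduces the ratio to the one in \<open>A1\<close>.
  The q-binomial coefficients are then those of \<open>A1\<close>, and the two operators differ only
  in a power of q.\<close>

lemma A2_nth:
  fixes f :: "'n::finite mseries"
  assumes "Re h < 0"
  shows "A2 h m mt f \<mu> = (\<Sum>\<nu>\<in>below \<mu>. f \<nu> *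
    ((\<Prod>a\<in>UNIV. qbin h (ev' \<nu> a + mt a) (\<mu> a - \<nu> a)) *
      qp h (\<Sum>a\<in>UNIV. - ((ev' \<nu> a + m a) * of_nat (\<mu> a - \<nu> a) + of_nat (\<nu> a) * ev' \<nu> a))))"
proof -
  have "fps_nth (phi_fps h (qp h (mt a - m a)) / phi_fps h (qp h (- ev' \<nu> a - m a))
      * fps_const (qp h (- of_nat (\<nu> a) * ev' \<nu> a))) (\<mu> a - \<nu> a)
    = qbin h (ev' \<nu> a + mt a) (\<mu> a - \<nu> a) *
      qp h (- ((ev' \<nu> a + m a) * of_nat (\<mu> a - \<nu> a) + of_nat (\<nu> a) * ev' \<nu> a))" for \<nu> a
  proof -
    let ?c = "qp h (- ev' \<nu> a - m a)"
    have "qp h (mt a - m a) = qp h (ev' \<nu> a + mt a) * ?c"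
      by (simp add: qp_add[symmetric])
    then have "phi_fps h (qp h (mt a - m a)) / phi_fps h ?c
        = (phi_fps h (qp h (ev' \<nu> a + mt a)) / phi_fps h 1) oo (fps_const ?c * fps_X)"
      using phi_fps_ratio_scale[OF assms, of "qp h (ev' \<nu> a + mt a)" ?c 1] by (simp only: mult_1_left)
    then have "fps_nth (phi_fps h (qp h (mt a - m a)) / phi_fps h ?c) (\<mu> a - \<nu> a)
        = ?c ^ (\<mu> a - \<nu> a) * qbin h (ev' \<nu> a + mt a) (\<mu> a - \<nu> a)"
      by (simp only: fps_compose_linear fps_nth_Abs_fps phi_fps_ratio_nth[OF assms])
    moreover have "qp h (- ((ev' \<nu> a + m a) * of_nat (\<mu> a - \<nu> a) + of_nat (\<nu> a) * ev' \<nu> a))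
        = ?c ^ (\<mu> a - \<nu> a) * qp h (- of_nat (\<nu> a) * ev' \<nu> a)"
      unfolding qp_power qp_add[symmetric]
      by (rule arg_cong[of _ _ "qp h"]) (simp add: algebra_simps)
    ultimately show ?thesis
      by (simp only: fps_mult_right_const_nth) (simp only: mult_ac)
  qed
  then show ?thesis
    unfolding A2_def normal_order_def prod_series_def by (simp only: prod.distrib qp_sum)
qed

text \<open>As \<open>A1\<close> and \<open>A2\<close> share their q-binomial factors, their
  difference divided by h contains h only through these factors, \<open>f h\<close> and (q^A - q^B)
  / h, and the last tends to A - B.\<close>

lemma limit_of_difference_equation:
  fixes f :: "complex \<Rightarrow> 'n::finite mseries"
  assumes lim: "\<And>\<nu>. ((\<lambda>h. f h \<nu>) \<longlongrightarrow> g \<nu>) (at 0 within S)"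
    and "0 islimpt S" and "\<And>h. h \<in> S \<Longrightarrow> Re h < 0"
    and eq: "\<And>h. h \<in> S \<Longrightarrow> A1 h \<gamma> mt (f h) = A2 h m mt (f h)"
  shows "(\<Sum>\<nu>\<in>below \<mu>. g \<nu> * ((\<Prod>a\<in>UNIV. nbin (ev' \<nu> a + mt a) (\<mu> a - \<nu> a)) *
    (\<Sum>a\<in>UNIV. of_nat (\<nu> a) * (\<gamma> a + ev' \<nu> a) + (ev' \<nu> a + m a) * of_nat (\<mu> a - \<nu> a)))) = 0"
    (is "?lhs = 0")
proof -
  let ?A = "\<lambda>\<nu>. \<Sum>a\<in>UNIV. \<gamma> a * of_nat (\<nu> a)"
  let ?B = "\<lambda>\<nu>. \<Sum>a\<in>UNIV. - ((ev' \<nu> a + m a) * of_nat (\<mu> a - \<nu> a) + of_nat (\<nu> a) * ev' \<nu> a)"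
  let ?P = "\<lambda>h \<nu>. \<Prod>a\<in>UNIV. qbin h (ev' \<nu> a + mt a) (\<mu> a - \<nu> a)"
  have AB: "?A \<nu> - ?B \<nu> = (\<Sum>a\<in>UNIV. of_nat (\<nu> a) * (\<gamma> a + ev' \<nu> a) + (ev' \<nu> a + m a) * of_nat (\<mu> a - \<nu> a))" for \<nu>
    unfolding sum_subtractf[symmetric] by (rule sum.cong) (simp_all add: algebra_simps)
  have "((\<lambda>h. \<Sum>\<nu>\<in>below \<mu>. f h \<nu> * (?P h \<nu> * ((qp h (?A \<nu>) - qp h (?B \<nu>)) / h)))
      \<longlongrightarrow> (\<Sum>\<nu>\<in>below \<mu>. g \<nu> * ((\<Prod>a\<in>UNIV. nbin (ev' \<nu> a + mt a) (\<mu> a - \<nu> a)) * (?A \<nu> - ?B \<nu>)))) (at 0 within S)"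
    by (intro tendsto_sum tendsto_mult tendsto_prod lim tendsto_qbin tendsto_qp_diff_div)
  moreover have "(\<Sum>\<nu>\<in>below \<mu>. f h \<nu> * (?P h \<nu> * ((qp h (?A \<nu>) - qp h (?B \<nu>)) / h))) = 0" if "h \<in> S" for h
  proof -
    have "(\<Sum>\<nu>\<in>below \<mu>. f h \<nu> * (?P h \<nu> * ((qp h (?A \<nu>) - qp h (?B \<nu>)) / h)))
        = (A1 h \<gamma> mt (f h) \<mu> - A2 h m mt (f h) \<mu>) / h"
      unfolding A1_nth[OF assms(3)[OF that]] A2_nth[OF assms(3)[OF that]]
        sum_subtractf[symmetric] sum_divide_distrib
      by (rule sum.cong) (simp_all only: right_diff_distrib times_divide_eq_right)
    then show ?thesis using eq[OF that] by simp
  qed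
  then have "((\<lambda>h. \<Sum>\<nu>\<in>below \<mu>. f h \<nu> * (?P h \<nu> * ((qp h (?A \<nu>) - qp h (?B \<nu>)) / h))) \<longlongrightarrow> 0) (at 0 within S)"
    by (intro tendsto_eventually) (simp add: eventually_at_filter)
  moreover have "at 0 within S \<noteq> bot"
    using assms(2) by (simp add: trivial_limit_within)
  ultimately show ?thesis
    unfolding AB[symmetric] by (rule tendsto_unique[rotated])
qed

text \<open>The limit is \<open>:\<Prod>\<^sub>b (1 - x\<^sub>b)\<^bsup>-\<theta>'\<^sub>b - mt\<^sub>b\<^esup>:\<close> applied to the left-hand side \<open>D\<close> of the
  four-dimensional equation, and this operator is injective.\<close>
lemma equation_4d_of_limit:
  fixes g :: "'n::finite mseries"
  assumes "\<And>\<mu>. (\<Sum>\<nu>\<in>below \<mu>. g \<nu> * ((\<Prod>a\<in>UNIV. nbin (ev' \<nu> a + mt a) (\<mu> a - \<nu> a)) *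
    (\<Sum>a\<in>UNIV. of_nat (\<nu> a) * (\<gamma> a + ev' \<nu> a) + (ev' \<nu> a + m a) * of_nat (\<mu> a - \<nu> a)))) = 0"
  shows "equation_4d \<gamma> m mt g"
proof -
  \<comment> \<open>\<open>F\<close> is the symbol of the common limit of \<open>A1\<close> and
    \<open>A2\<close> at h = 0.\<close>
  define F where "F \<tau> \<rho> = (\<Prod>b\<in>UNIV. nbin (ev' \<tau> b + mt b) (\<rho> b))" for \<tau> \<rho> :: "'n expo"
  define W where "W a = mmult (U a) (inverse_1_Lambda :: 'n mseries)" for a
  define P where "P a \<nu> = (m a + ev' \<nu> a) * (mt a + ev' \<nu> a) * g \<nu>" for a \<nu>
  define D where "D \<mu> = (\<Sum>a\<in>UNIV. of_nat (\<mu> a) * (\<gamma> a + ev' \<mu> a) * g \<mu>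
      + (\<Sum>\<rho>\<in>below \<mu>. W a \<rho> * P a (\<lambda>b. \<mu> b - \<rho> b)))" for \<mu>
  have D: "(\<Sum>a\<in>UNIV. theta a (add_theta' (\<gamma> a) a g) \<mu>
        + mmult (mmult (U a) inverse_1_Lambda) (add_theta' (m a) a (add_theta' (mt a) a g)) \<mu>) = D \<mu>" for \<mu>
  proof -
    have ev: "add_theta' c a u \<nu> = (c + ev' \<nu> a) * u \<nu>" for c a \<nu> and u :: "'n mseries"
      by (simp add: add_theta'_def theta'_def theta_def ev'_def algebra_simps)
    show ?thesis
      unfolding D_def P_def W_def mmult_def[of "mmult _ _"] ev theta_def by (simp only: mult.assoc)
  qed
  have "D \<mu> = 0" for \<mu>
  proof (rule normal_order_eq_0D[of F])
    show "F \<nu> (\<lambda>_. 0) = 1" for \<nu> by (simp add: F_def)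
    show "normal_order F D \<mu> = 0" for \<mu>
    proof -
      \<comment> \<open>With \<tau> = \<nu> + \<rho>, the exponents in \<open>F\<close> are shifted
        by \<theta>' of the run \<rho>. For fixed \<nu> the telescoping sum over \<rho>, with s_b =
        \<theta>'_b + mt_b, absorbs the factor mt_a + \<theta>'_a and leaves \<mu> a - \<nu>
        a.\<close>
      have conv: "(\<Sum>\<tau>\<in>below \<mu>. \<Sum>\<rho>\<in>below \<tau>. W a \<rho> * P a (\<lambda>b. \<tau> b - \<rho> b) * F \<tau> (\<lambda>b. \<mu> b - \<tau> b))
          = (\<Sum>\<nu>\<in>below \<mu>. (m a + ev' \<nu> a) * g \<nu> * (of_nat (\<mu> a - \<nu> a) * F \<nu> (\<lambda>b. \<mu> b - \<nu> b)))" for a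
      proof -
        have "(\<Sum>\<tau>\<in>below \<mu>. \<Sum>\<rho>\<in>below \<tau>. W a \<rho> * P a (\<lambda>b. \<tau> b - \<rho> b) * F \<tau> (\<lambda>b. \<mu> b - \<tau> b))
          = (\<Sum>\<tau>\<in>below \<mu>. \<Sum>\<rho>\<in>below \<tau>. W a \<rho> * P a (\<lambda>b. \<tau> b - \<rho> b)
              * F (\<lambda>b. (\<tau> b - \<rho> b) + \<rho> b) (\<lambda>b. \<mu> b - \<tau> b))"
        proof (intro sum.cong refl)
          fix \<tau> \<rho> :: "'n expo" assume "\<rho> \<in> below \<tau>"
          then have "(\<lambda>b. (\<tau> b - \<rho> b) + \<rho> b) = \<tau>" by (simp add: fun_eq_iff)
          then show "W a \<rho> * P a (\<lambda>b. \<tau> b - \<rho> b) * F \<tau> (\<lambda>b. \<mu> b - \<tau> b)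
            = W a \<rho> * P a (\<lambda>b. \<tau> b - \<rho> b) * F (\<lambda>b. (\<tau> b - \<rho> b) + \<rho> b) (\<lambda>b. \<mu> b - \<tau> b)"
            by (simp only:)
        qed
        also have "\<dots> = (\<Sum>\<nu>\<in>below \<mu>. \<Sum>\<rho>\<in>below (\<lambda>b. \<mu> b - \<nu> b).
            W a \<rho> * P a \<nu> * F (\<lambda>b. \<nu> b + \<rho> b) (\<lambda>b. \<mu> b - \<nu> b - \<rho> b))"
          by (rule sum_below_convolution[where H="\<lambda>\<rho> \<nu> \<kappa>. W a \<rho> * P a \<nu> * F (\<lambda>b. \<nu> b + \<rho> b) \<kappa>"])
        also have "\<dots> = (\<Sum>\<nu>\<in>below \<mu>. (m a + ev' \<nu> a) * g \<nu> * (of_nat (\<mu> a - \<nu> a) * F \<nu> (\<lambda>b. \<mu> b - \<nu> b)))"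
        proof (intro sum.cong refl)
          fix \<nu> :: "'n expo"
          have ev: "ev' (\<lambda>b. \<nu> b + \<rho> b) b + mt b = (ev' \<nu> b + mt b) + ev' \<rho> b" for \<rho> b
            by (simp add: ev'_def)
          have "(\<Sum>\<rho>\<in>below (\<lambda>b. \<mu> b - \<nu> b). W a \<rho> * P a \<nu> * F (\<lambda>b. \<nu> b + \<rho> b) (\<lambda>b. \<mu> b - \<nu> b - \<rho> b))
            = P a \<nu> * (\<Sum>\<rho>\<in>below (\<lambda>b. \<mu> b - \<nu> b). W a \<rho> *
                (\<Prod>b\<in>UNIV. nbin ((ev' \<nu> b + mt b) + ev' \<rho> b) ((\<mu> b - \<nu> b) - \<rho> b)))"
            unfolding F_def ev sum_distrib_left by (simp only: mult_ac)
          also have "\<dots> = (m a + ev' \<nu> a) * g \<nu> * ((ev' \<nu> a + mt a) * (\<Sum>\<rho>\<in>below (\<lambda>b. \<mu> b - \<nu> b). W a \<rho> *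
                (\<Prod>b\<in>UNIV. nbin ((ev' \<nu> b + mt b) + ev' \<rho> b) ((\<mu> b - \<nu> b) - \<rho> b))))"
            unfolding P_def by (simp only: mult_ac add.commute[of "mt a"])
          also have "\<dots> = (m a + ev' \<nu> a) * g \<nu> * (of_nat (\<mu> a - \<nu> a) * F \<nu> (\<lambda>b. \<mu> b - \<nu> b))"
            unfolding W_def F_def
            by (subst sum_cyclic_run_telescope[where s="\<lambda>b. ev' \<nu> b + mt b" and \<sigma>="\<lambda>b. \<mu> b - \<nu> b"]) (rule refl)
          finally show "(\<Sum>\<rho>\<in>below (\<lambda>b. \<mu> b - \<nu> b). W a \<rho> * P a \<nu> * F (\<lambda>b. \<nu> b + \<rho> b) (\<lambda>b. \<mu> b - \<nu> b - \<rho> b))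
            = (m a + ev' \<nu> a) * g \<nu> * (of_nat (\<mu> a - \<nu> a) * F \<nu> (\<lambda>b. \<mu> b - \<nu> b))" .
        qed
        finally show ?thesis .
      qed
      have "normal_order F D \<mu> = (\<Sum>\<tau>\<in>below \<mu>. \<Sum>a\<in>UNIV. of_nat (\<tau> a) * (\<gamma> a + ev' \<tau> a) * g \<tau> * F \<tau> (\<lambda>b. \<mu> b - \<tau> b)
          + (\<Sum>\<rho>\<in>below \<tau>. W a \<rho> * P a (\<lambda>b. \<tau> b - \<rho> b) * F \<tau> (\<lambda>b. \<mu> b - \<tau> b)))"
        unfolding normal_order_def D_def by (simp only: sum_distrib_right distrib_right)
      also have "\<dots> = (\<Sum>a\<in>UNIV. (\<Sum>\<tau>\<in>below \<mu>. of_nat (\<tau> a) * (\<gamma> a + ev' \<tau> a) * g \<tau> * F \<tau> (\<lambda>b. \<mu> b - \<tau> b))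
          + (\<Sum>\<tau>\<in>below \<mu>. \<Sum>\<rho>\<in>below \<tau>. W a \<rho> * P a (\<lambda>b. \<tau> b - \<rho> b) * F \<tau> (\<lambda>b. \<mu> b - \<tau> b)))"
        by (subst sum.swap) (simp only: sum.distrib)
      also have "\<dots> = (\<Sum>a\<in>UNIV. \<Sum>\<nu>\<in>below \<mu>. g \<nu> * (F \<nu> (\<lambda>b. \<mu> b - \<nu> b) *
          (of_nat (\<nu> a) * (\<gamma> a + ev' \<nu> a) + (ev' \<nu> a + m a) * of_nat (\<mu> a - \<nu> a))))"
        unfolding conv sum.distrib[symmetric]
        by (intro sum.cong refl) (simp only: algebra_simps)
      also have "\<dots> = (\<Sum>\<nu>\<in>below \<mu>. g \<nu> * (F \<nu> (\<lambda>b. \<mu> b - \<nu> b) *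
          (\<Sum>a\<in>UNIV. of_nat (\<nu> a) * (\<gamma> a + ev' \<nu> a) + (ev' \<nu> a + m a) * of_nat (\<mu> a - \<nu> a))))"
        by (subst sum.swap) (simp only: sum_distrib_left)
      also have "\<dots> = 0"
        unfolding F_def by (rule assms)
      finally show ?thesis .
    qed
  qed
  then show ?thesis
    unfolding equation_4d_def D by blast
qed

section \<open>From the Hamiltonian to the difference equation\<close>

lemma prod_series_0:
  assumes "\<And>a. fps_nth (g a) 0 = 1"
  shows "prod_series g (\<lambda>_. 0) = 1"
  by (simp add: prod_series_def assms)

text \<open>Apply \<open>A_L_inv\<close>, multiply by the product of \<open>phi\<close> at the
  conjugate parameters, which cancels half of \<open>A_C\<close>, and replace x_a by x_a / d_a. The
  two sides become the ratios in \<open>A2\<close> and \<open>A1\<close>.\<close>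

lemma hamiltonian_fixed_imp_A1_eq_A2:
  fixes m mt \<gamma> \<beta> :: "'n::finite mod_ring \<Rightarrow> complex"
  assumes h: "Re h < 0"
    and gamma: "\<And>a. qp h k * qp h (\<beta> a) / qp h (\<beta> (nxt a)) = qp h (\<gamma> a)"
    and fixed: "hamiltonian h k \<beta> m mt f = f"
    and g: "g = rescale (\<lambda>a. 1 / qp h (m a)) (q_half_Delta h f)"
  shows "A1 h \<gamma> mt g = A2 h m mt g"
proof -
  define c where "c a = 1 / qp h (m a)" for a
  define v where "v = q_half_Delta h (shift_T h k \<beta> f)"
  define w where "w = A_L h (A_C h m mt (A_R h m mt v))"
  have unit: "is_unit (phi_fps h z)" for z
    using h by simp
  have "q_half_Delta h w = f"
    using fixed by (simp add: hamiltonian_def w_def v_def)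
  then have w: "w \<nu> = qp h (- evDelta \<nu> / 2) * f \<nu>" for \<nu>
    by (auto simp: q_half_Delta_def qp_minus)
  have surj: "surj (A_L_inv h :: 'n mseries \<Rightarrow> 'n mseries)"
    unfolding A_L_inv_def
  proof (rule surj_normal_order)
    show "prod_series (\<lambda>i. 1 / phi_fps h (qp h (- ev' \<nu> i))) (\<lambda>_. 0) = 1" for \<nu> :: "'n expo"
      using h by (intro prod_series_0) (simp add: fps_divide_unit)
  qed
  have eq: "A_L_inv h w = A_C h m mt (A_R h m mt v)"
    unfolding w_def A_L_def by (rule surj_f_inv_f[OF surj])
  let ?Q = "prod_series (\<lambda>i. phi_fps h (qp h (mt i))) :: 'n mseries"
  have lhs: "rescale c (mmult ?Q (A_L_inv h w)) = normal_order (\<lambda>\<nu>. prod_series (\<lambda>a.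
      phi_fps h (qp h (mt a - m a)) / phi_fps h (qp h (- ev' \<nu> a - m a)))) (rescale c w)"
  proof -
    have "(phi_fps h (qp h (mt a)) * (1 / phi_fps h (qp h (- ev' \<nu> a)))) oo (fps_const (c a) * fps_X)
        = phi_fps h (qp h (mt a - m a)) / phi_fps h (qp h (- ev' \<nu> a - m a))" for a and \<nu> :: "'n expo"
    proof -
      have "phi_fps h (qp h (mt a)) * (1 / phi_fps h (qp h (- ev' \<nu> a)))
          = phi_fps h (qp h (mt a)) / phi_fps h (qp h (- ev' \<nu> a))"
        using unit by (simp add: fps_divide_unit)
      then show ?thesis
        by (simp add: phi_fps_ratio_scale[OF h, symmetric] c_def qp_diff)
    qed
    then show ?thesis
      by (simp only: A_L_inv_def mmult_normal_order mmult_prod_series rescale_normal_order rescale_prod_series)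
  qed
  have rhs: "rescale c (mmult ?Q (A_C h m mt (A_R h m mt v))) = normal_order (\<lambda>\<nu>. prod_series (\<lambda>a.
      phi_fps h (qp h (ev' \<nu> a + mt a)) / phi_fps h 1)) (rescale c v)"
  proof -
    have "(phi_fps h (qp h (mt a)) * (1 / (phi_fps h (qp h (m a)) * phi_fps h (qp h (mt a)))
          * phi_fps h (qp h (m a) * qp h (mt a) * qp h (ev' \<nu> a)))) oo (fps_const (c a) * fps_X)
        = phi_fps h (qp h (ev' \<nu> a + mt a)) / phi_fps h 1" for a and \<nu> :: "'n expo"
    proof -
      have cancel: "phi_fps h (qp h (mt a)) * (1 / (phi_fps h (qp h (m a)) * phi_fps h (qp h (mt a))) * X)
          = X / phi_fps h (qp h (m a))" for X
        using h by (simp add: fps_divide_unit fps_inverse_mult mult_ac inverse_mult_eq_1')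
      show ?thesis
        unfolding cancel phi_fps_ratio_scale[OF h, symmetric] by (simp add: c_def qp_add mult_ac)
    qed
    then show ?thesis
      by (simp only: A_C_def A_R_def mmult_normal_order mmult_prod_series rescale_normal_order rescale_prod_series)
  qed
  have "A2 h m mt g = normal_order (\<lambda>\<nu>. prod_series (\<lambda>a.
      phi_fps h (qp h (mt a - m a)) / phi_fps h (qp h (- ev' \<nu> a - m a)))) (rescale c w)"
  proof -
    \<comment> \<open>The sum of all \<theta>_a \<theta>'_a is \<Delta>, so the last factor of
      \<open>A2\<close> turns the q^(\<Delta>/2) in \<open>g\<close> into the q^(-\<Delta>/2) in
      \<open>w\<close>.\<close>
    have half: "qp h (evDelta \<nu> / 2) * (\<Prod>a\<in>UNIV. qp h (- of_nat (\<nu> a) * ev' \<nu> a)) = qp h (- evDelta \<nu> / 2)"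
      for \<nu> :: "'n expo"
    proof -
      have "(\<Sum>a\<in>UNIV. - of_nat (\<nu> a) * ev' \<nu> a) = - evDelta \<nu>"
        by (simp add: evDelta_def ev'_def sum_negf[symmetric] algebra_simps power2_eq_square)
      then have "(\<Prod>a\<in>UNIV. qp h (- of_nat (\<nu> a) * ev' \<nu> a)) = qp h (- evDelta \<nu>)"
        by (simp only: qp_sum[symmetric])
      then show ?thesis by (simp add: qp_add[symmetric])
    qed
    have gw: "g \<nu> * (X * (\<Prod>a\<in>UNIV. qp h (- of_nat (\<nu> a) * ev' \<nu> a))) = rescale c w \<nu> * X"
      for \<nu> X
    proof -
      have "g \<nu> * (X * (\<Prod>a\<in>UNIV. qp h (- of_nat (\<nu> a) * ev' \<nu> a)))
          = ((\<Prod>a\<in>UNIV. c a ^ \<nu> a) * f \<nu> * X) *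
            (qp h (evDelta \<nu> / 2) * (\<Prod>a\<in>UNIV. qp h (- of_nat (\<nu> a) * ev' \<nu> a)))"
        by (simp only: g rescale_def q_half_Delta_def c_def mult_ac)
      also have "\<dots> = rescale c w \<nu> * X"
        unfolding half by (simp only: rescale_def w mult_ac)
      finally show ?thesis .
    qed
    show ?thesis
      unfolding A2_def normal_order_def prod_series_def
      by (simp only: fps_mult_right_const_nth prod.distrib gw)
  qed
  moreover have "A1 h \<gamma> mt g = normal_order (\<lambda>\<nu>. prod_series (\<lambda>a.
      phi_fps h (qp h (ev' \<nu> a + mt a)) / phi_fps h 1)) (rescale c v)"
  proof -
    \<comment> \<open>By \<open>gamma\<close>, the factor q^(\<gamma>_a \<theta>_a) of
      \<open>A1\<close> is the shift T contained in \<open>v\<close>.\<close>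
    have "(\<Prod>a\<in>UNIV. qp h (\<gamma> a * of_nat (\<nu> a))) = (\<Prod>a\<in>UNIV. qp h (\<gamma> a) ^ \<nu> a)" for \<nu> :: "'n expo"
      by (simp add: qp_power mult.commute)
    then have gv: "g \<nu> * (X * (\<Prod>a\<in>UNIV. qp h (\<gamma> a * of_nat (\<nu> a)))) = rescale c v \<nu> * X" for \<nu> X
      by (simp only: g rescale_def q_half_Delta_def v_def shift_T_def gamma c_def mult_ac)
    show ?thesis
      unfolding A1_def normal_order_def prod_series_def
      by (simp only: fps_mult_right_const_nth prod.distrib gv)
  qed
  ultimately show ?thesis
    using lhs rhs eq by simp
qed

theorem theorem5p2:
  fixes m mt \<gamma> \<beta> :: "'n::finite mod_ring \<Rightarrow> complex" and k :: complex
  assumes gamma: "\<And>h a. qp h k * qp h (\<beta> a) / qp h (\<beta> (nxt a)) = qp h (\<gamma> a)"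
    and generic: "0 islimpt admissible k \<beta>"
  shows "(\<forall>\<nu>. ((\<lambda>h. psi5d h k \<beta> m mt \<nu>) \<longlongrightarrow> psi4d k \<beta> m mt \<nu>) (at 0 within admissible k \<beta>)) \<and>
    (laumon_conjecture TYPE('n) \<longrightarrow> equation_4d \<gamma> m mt (psi4d k \<beta> m mt)) \<and>
    ((\<forall>h\<in>admissible k \<beta>. A1 h \<gamma> mt (psi5d h k \<beta> m mt) = A2 h m mt (psi5d h k \<beta> m mt))
       \<longrightarrow> equation_4d \<gamma> m mt (psi4d k \<beta> m mt))"
proof (intro conjI impI allI)
  show lim: "((\<lambda>h. psi5d h k \<beta> m mt \<nu>) \<longlongrightarrow> psi4d k \<beta> m mt \<nu>) (at 0 within admissible k \<beta>)" for \<nu>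
    by (rule psi5d_convergent[OF generic])
  have Re: "Re h < 0" if "h \<in> admissible k \<beta>" for h
    using that by (simp add: admissible_def)
  \<comment> \<open>Both implications end here; they differ only in where the difference equation
    comes from.\<close>
  have limit: "equation_4d \<gamma> m mt (psi4d k \<beta> m mt)"
    if "\<And>h. h \<in> admissible k \<beta> \<Longrightarrow> A1 h \<gamma> mt (psi5d h k \<beta> m mt) = A2 h m mt (psi5d h k \<beta> m mt)"
    by (rule equation_4d_of_limit, rule limit_of_difference_equation[OF lim generic Re that])
  show "equation_4d \<gamma> m mt (psi4d k \<beta> m mt)" if "laumon_conjecture TYPE('n)"
  proof (rule limit)
    fix h assume h: "h \<in> admissible k \<beta>"
    have "hamiltonian h k \<beta> m mt (psi h k \<beta> m mt) = psi h k \<beta> m mt"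
      using h that unfolding laumon_conjecture_def by blast
    then show "A1 h \<gamma> mt (psi5d h k \<beta> m mt) = A2 h m mt (psi5d h k \<beta> m mt)"
      using hamiltonian_fixed_imp_A1_eq_A2[where k=k and \<beta>=\<beta> and \<gamma>=\<gamma>, OF Re[OF h] gamma]
        psi5d_def by blast
  qed
  show "equation_4d \<gamma> m mt (psi4d k \<beta> m mt)"
    if "\<forall>h\<in>admissible k \<beta>. A1 h \<gamma> mt (psi5d h k \<beta> m mt) = A2 h m mt (psi5d h k \<beta> m mt)"
    using that by (intro limit) blast
qed

end
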